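(* For $1 \le p < \infty$ let $C_p$ be the real variable Cesàro operator on $L^p(0,1)$, $(C_p f)(x) = \frac{1}{x}\int_0^x \frac{f(t)}{1-t}\,dt$, $0<x<1$. Then $C_p$ is bounded on $L^p(0,1)$ when $1<p<\infty$, while $C_1$ is unbounded on $L^1(0,1)$. Moreover, for $1<p<\infty$ with Hölder conjugate index $q$, the following hold. (a) $\|C_p\| = q$ if $1<p<2$, and $\|C_p\| = p$ if $p\ge 2$. (b) The point spectrum of $C_p$ is the open crescent domain $D(\frac q2,\frac q2)\setminus \overline{D(\frac p2,\frac p2)}$ when $1<p<2$, and is empty when $p\ge 2$. (c) The spectrum of $C_p$ is $$\sigma(C_p)=\begin{cases}\overline{D(\frac q2,\frac q2)}\setminus D(\frac p2,\frac p2) & \text{if } 1<p<2,\\[3pt] \overline{D(\frac p2,\frac p2)}\setminus D(\frac q2,\frac q2) & \text{if } p\ge 2.\end{cases}$$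
   Context: $L^p(0,1)$ is the space of complex-valued $p$-integrable functions on $(0,1)$ with Lebesgue measure. $q$ denotes the Hölder conjugate index of $p$, i.e. $\frac1p+\frac1q=1$. $\|C_p\|$ is the operator norm of $C_p$ on $L^p(0,1)$. $D(a,r)=\{z\in\mathbb{C}:|z-a|<r\}$ and $\overline{D(a,r)}$ is its closure. $\sigma(C_p)$ is the spectrum of $C_p$ as an operator on $L^p(0,1)$; the point spectrum of $C_p$ is its set of eigenvalues. *)

theory Defs
  imports "HOL-Analysis.Analysis"
begin

abbreviation I01 :: "real measure" where
  "I01 \<equiv> restrict_space lborel {0<..<1}"

text \<open>The complex-valued measurable functions on the unit interval modulo equality almost
  everywhere. Every Lebesgue measurable function agrees almost everywhere with a Borel
  measurable one, so working with \<^const>\<open>lborel\<close> loses no class.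
  The values of a representative outside the interval are irrelevant.\<close>

definition ae_eq :: "(real \<Rightarrow> complex) \<Rightarrow> (real \<Rightarrow> complex) \<Rightarrow> bool" where
  "ae_eq f g \<longleftrightarrow> f \<in> borel_measurable I01 \<and> g \<in> borel_measurable I01 \<and> (AE x in I01. f x = g x)"

lemma part_equivp_ae_eq: "part_equivp ae_eq"
proof (rule part_equivpI)
  show "\<exists>f. ae_eq f f"
    by (rule exI[of _ "\<lambda>_. 0"]) (simp add: ae_eq_def)
  show "symp ae_eq"
    by (auto simp: symp_def ae_eq_def eq_commute)
  show "transp ae_eq"
  proof (rule transpI)
    fix f g h assume fg: "ae_eq f g" and gh: "ae_eq g h"
    have "AE x in I01. f x = g x" "AE x in I01. g x = h x"
      using fg gh by (auto simp: ae_eq_def)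
    then have "AE x in I01. f x = h x"
      by eventually_elim simp
    then show "ae_eq f h" using fg gh by (simp add: ae_eq_def)
  qed
qed

quotient_type L0 = "real \<Rightarrow> complex" / partial: ae_eq
  by (rule part_equivp_ae_eq)

lemma ae_eqI:
  assumes "f \<in> borel_measurable I01" "g \<in> borel_measurable I01" "AE x in I01. f x = g x"
  shows "ae_eq f g"
  using assms by (simp add: ae_eq_def)

instantiation L0 :: ab_group_add
begin

lift_definition zero_L0 :: L0 is "\<lambda>_. 0"
  by (simp add: ae_eq_def)

lift_definition plus_L0 :: "L0 \<Rightarrow> L0 \<Rightarrow> L0" is "\<lambda>f g x. f x + g x"
  by (auto simp: ae_eq_def elim: eventually_elim2)

lift_definition minus_L0 :: "L0 \<Rightarrow> L0 \<Rightarrow> L0" is "\<lambda>f g x. f x - g x"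
  by (auto simp: ae_eq_def elim: eventually_elim2)

lift_definition uminus_L0 :: "L0 \<Rightarrow> L0" is "\<lambda>f x. - f x"
  by (auto simp: ae_eq_def)

instance
  by standard (transfer, auto simp: ae_eq_def elim: eventually_elim2 intro: borel_measurable_add)+

end

lift_definition scaleL0 :: "complex \<Rightarrow> L0 \<Rightarrow> L0" (infixr \<open>*\<^sub>L\<close> 75) is "\<lambda>c f x. c * f x"
  by (auto simp: ae_eq_def)

lemma vector_space_L0: "vector_space scaleL0"
  by unfold_locales
    (transfer, auto simp: ae_eq_def algebra_simps intro!: borel_measurable_add borel_measurable_times)+

lift_definition in_Lp :: "real \<Rightarrow> L0 \<Rightarrow> bool" is
  "\<lambda>p f. integrable I01 (\<lambda>x. norm (f x) powr p)"
  by (intro integrable_cong_AE) (auto simp: ae_eq_def)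

definition Lp_space :: "real \<Rightarrow> L0 set" where
  "Lp_space p = {f. in_Lp p f}"

text \<open>Only meaningful for elements of \<open>Lp_space p\<close>.\<close>

lift_definition Lp_norm :: "real \<Rightarrow> L0 \<Rightarrow> real" is
  "\<lambda>p f. (\<integral>x. norm (f x) powr p \<partial>I01) powr (1 / p)"
  by (intro arg_cong[where f = "\<lambda>a. a powr _"] integral_cong_AE) (auto simp: ae_eq_def)

definition Lp_bounded :: "real \<Rightarrow> (L0 \<Rightarrow> L0) \<Rightarrow> bool" where
  "Lp_bounded p T \<longleftrightarrow>
    T ` Lp_space p \<subseteq> Lp_space p \<and>
    (\<forall>f\<in>Lp_space p. \<forall>g\<in>Lp_space p. T (f + g) = T f + T g) \<and>
    (\<forall>c. \<forall>f\<in>Lp_space p. T (c *\<^sub>L f) = c *\<^sub>L T f) \<and>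
    (\<exists>K. \<forall>f\<in>Lp_space p. Lp_norm p (T f) \<le> K * Lp_norm p f)"

text \<open>Unboundedness of \<open>T\<close> on its maximal domain, that is, on those \<open>f\<close> in the space
  whose image lies in the space again. This is stronger than the negation of
  \<open>Lp_bounded\<close>, which would already hold if \<open>T\<close> failed to map the space into itself.\<close>

definition Lp_unbounded :: "real \<Rightarrow> (L0 \<Rightarrow> L0) \<Rightarrow> bool" where
  "Lp_unbounded p T \<longleftrightarrow>
    (\<forall>K. \<exists>f\<in>Lp_space p. T f \<in> Lp_space p \<and> Lp_norm p (T f) > K * Lp_norm p f)"

definition Lp_opnorm :: "real \<Rightarrow> (L0 \<Rightarrow> L0) \<Rightarrow> real" where
  "Lp_opnorm p T = (SUP f \<in> {f \<in> Lp_space p. Lp_norm p f \<le> 1}. Lp_norm p (T f))"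

definition Lp_spectrum :: "real \<Rightarrow> (L0 \<Rightarrow> L0) \<Rightarrow> complex set" where
  "Lp_spectrum p T = {z. \<not> (\<exists>S. Lp_bounded p S \<and>
    (\<forall>f\<in>Lp_space p. S (z *\<^sub>L f - T f) = f \<and> z *\<^sub>L S f - T (S f) = f))}"

definition Lp_point_spectrum :: "real \<Rightarrow> (L0 \<Rightarrow> L0) \<Rightarrow> complex set" where
  "Lp_point_spectrum p T = {z. \<exists>f\<in>Lp_space p. f \<noteq> 0 \<and> T f = z *\<^sub>L f}"

definition cesaro_fun :: "(real \<Rightarrow> complex) \<Rightarrow> real \<Rightarrow> complex" where
  "cesaro_fun f x = 1 / of_real x * (LINT t:{0<..<x}|lborel. f t / (1 - of_real t))"

lemma cesaro_fun_eq_I01: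
  assumes "0 < x" "x < 1"
  shows "cesaro_fun f x =
    1 / of_real x * (LINT t|I01. indicator {0<..<x} t *\<^sub>R (f t / (1 - of_real t)))"
proof -
  have "(LINT t|I01. indicator {0<..<x} t *\<^sub>R (f t / (1 - of_real t))) =
    (LINT t|lborel. indicator {0<..<1} t *\<^sub>R (indicator {0<..<x} t *\<^sub>R (f t / (1 - of_real t))))"
    by (simp add: integral_restrict_space)
  also have "\<dots> = (LINT t:{0<..<x}|lborel. f t / (1 - of_real t))"
    unfolding set_lebesgue_integral_def
    using assms by (intro Bochner_Integration.integral_cong) (auto simp: indicator_def)
  finally show ?thesis by (simp add: cesaro_fun_def)
qed

lemma measurable_cesaro_fun:
  assumes f [measurable]: "f \<in> borel_measurable I01"
  shows "cesaro_fun f \<in> borel_measurable I01"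
proof -
  interpret sigma_finite_measure I01
    by (rule sigma_finite_measure_restrict_space) (auto intro: lborel.sigma_finite_measure_axioms)
  have [measurable]: "(\<lambda>x::real. x) \<in> borel_measurable I01"
    by (rule measurable_restrict_space1) simp
  have "(\<lambda>z. if 0 < snd z \<and> snd z < fst z then 1 else 0 :: real) \<in> borel_measurable (I01 \<Otimes>\<^sub>M I01)"
    by measurable
  then have [measurable]: "(\<lambda>z. indicator {0<..<fst z} (snd z) :: real) \<in> borel_measurable (I01 \<Otimes>\<^sub>M I01)"
    by (simp add: indicator_def)
  have "(\<lambda>x. 1 / of_real x * (LINT t|I01. indicator {0<..<x} t *\<^sub>R (f t / (1 - of_real t))))
      \<in> borel_measurable I01"
    by measurable
  then show ?thesis
    by (rule measurable_cong[THEN iffD1, rotated]) (simp add: cesaro_fun_eq_I01 space_restrict_space)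
qed

lemma cesaro_fun_cong_AE:
  assumes "ae_eq f g" "0 < x" "x < 1"
  shows "cesaro_fun f x = cesaro_fun g x"
proof -
  have [measurable]: "f \<in> borel_measurable I01" "g \<in> borel_measurable I01"
    "(\<lambda>x::real. x) \<in> borel_measurable I01"
    using assms by (auto simp: ae_eq_def intro: measurable_restrict_space1)
  have [measurable]: "(indicator {0<..<x} :: real \<Rightarrow> real) \<in> borel_measurable I01"
    by (intro measurable_restrict_space1) simp
  have "AE t in I01. f t = g t" using assms by (simp add: ae_eq_def)
  then show ?thesis
    unfolding cesaro_fun_eq_I01[OF assms(2,3)]
    by (intro arg_cong2[where f = "(*)"] integral_cong_AE refl) auto
qed

text \<open>For \<open>f\<close> in \<open>Lp_space p\<close> with \<open>p \<ge> 1\<close> the integral defining the Cesaro operator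
  converges absolutely for all \<open>0 < x < 1\<close> (see below), so the operators on the different
  spaces are restrictions of this single map. Outside these spaces its values are irrelevant.\<close>

lift_definition cesaro :: "L0 \<Rightarrow> L0" is cesaro_fun
proof -
  fix f g assume fg: "ae_eq f g"
  then show "ae_eq (cesaro_fun f) (cesaro_fun g)"
    by (intro ae_eqI AE_I2 measurable_cesaro_fun cesaro_fun_cong_AE[OF fg])
      (auto simp: ae_eq_def space_restrict_space)
qed

lemma cesaro_integrable:
  fixes f :: "real \<Rightarrow> complex"
  assumes f: "f \<in> borel_measurable I01" "integrable I01 (\<lambda>x. norm (f x) powr p)"
    and "1 \<le> p" "0 < x" "x < 1"
  shows "set_integrable lborel {0<..<x} (\<lambda>t. f t / (1 - of_real t))"
proof -
  note f(1) [measurable]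
  have [measurable]: "(\<lambda>x::real. x) \<in> borel_measurable I01"
    "(indicator {0<..<x} :: real \<Rightarrow> real) \<in> borel_measurable I01"
    by (rule measurable_restrict_space1, simp)+
  interpret finite_measure I01
    by (rule finite_measureI) (simp add: emeasure_restrict_space space_restrict_space)
  have "integrable I01 (\<lambda>t. (1 + norm (f t) powr p) / (1 - x))"
    using f(2) by simp
  then have "integrable I01 (\<lambda>t. indicator {0<..<x} t *\<^sub>R (f t / (1 - of_real t)))"
  proof (rule Bochner_Integration.integrable_bound)
    show "(\<lambda>t. indicator {0<..<x} t *\<^sub>R (f t / (1 - of_real t))) \<in> borel_measurable I01"
      by measurable
    show "AE t in I01. norm (indicator {0<..<x} t *\<^sub>R (f t / (1 - of_real t)))
        \<le> norm ((1 + norm (f t) powr p) / (1 - x))"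
    proof (rule AE_I2)
      fix t
      show "norm (indicator {0<..<x} t *\<^sub>R (f t / (1 - of_real t)))
        \<le> norm ((1 + norm (f t) powr p) / (1 - x))"
      proof (cases "t \<in> {0<..<x}")
        case True
        have "norm (f t) \<le> 1 + norm (f t) powr p"
        proof (cases "norm (f t) \<le> 1")
          case False
          then have "norm (f t) powr 1 \<le> norm (f t) powr p"
            using \<open>1 \<le> p\<close> by (intro powr_mono) auto
          then show ?thesis using False by simp
        qed (simp add: add_increasing2)
        moreover have "norm (1 - complex_of_real t) = 1 - t"
          using True \<open>x < 1\<close> norm_of_real[of "1 - t", where 'a = complex] by simp
        ultimately show ?thesis
          using True \<open>x < 1\<close> by (auto simp: norm_divide intro!: frac_le)
      qed simp
    qed
  qed
  then have "integrable lborel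
      (\<lambda>t. indicator {0<..<1} t *\<^sub>R (indicator {0<..<x} t *\<^sub>R (f t / (1 - of_real t))))"
    by (subst (asm) integrable_restrict_space) auto
  moreover have "(\<lambda>t. indicator {0<..<1} t *\<^sub>R (indicator {0<..<x} t *\<^sub>R (f t / (1 - of_real t)))) =
      (\<lambda>t. indicator {0<..<x} t *\<^sub>R (f t / (1 - of_real t)))"
    using \<open>x < 1\<close> by (auto simp: indicator_def fun_eq_iff)
  ultimately show ?thesis by (simp add: set_integrable_def)
qed

end

theory Submission
  imports Defs
begin

text \<open>The substitution \<open>u = t / (1 - t)\<close>, together with \<open>g u = (1 - t) * f t\<close>, turns the Cesaro operator into Hardy's averaging
  operator \<open>g \<mapsto> (1 / u) * (integral of g over {0..u})\<close> on the space \<open>L\<^sup>p\<close> of the half-line with weight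
  \<open>(1 + u) powr (p - 2)\<close>. Hardy's operator commutes with dilations and maps the power \<open>u powr (z - 1)\<close> to \<open>1 / z\<close> times itself
  if \<open>Re z > 0\<close>. The weight behaves like \<open>1\<close> at \<open>0\<close> and like \<open>u powr (p - 2)\<close> at infinity, so these powers are
  \<open>p\<close>-integrable at \<open>0\<close> if and only if \<open>Re z > 1 - 1 / p\<close>, and at infinity if and only if \<open>Re z < 1 / p\<close>. The whole theorem
  reflects the position of \<open>Re (1 / w)\<close> relative to the two numbers \<open>1 / p\<close> and \<open>1 / q = 1 - 1 / p\<close>; since inversion maps
  vertical lines to circles through \<open>0\<close> (\<open>disk_iff_Re_inverse\<close>), the conditions on \<open>Re (1 / w)\<close> become the disks. The
  coordinate \<open>ln u\<close> appears below as \<open>logit\<close>.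

  Eigenvalues. If \<open>cesaro f = w f\<close> with \<open>w \<noteq> 0\<close>, the primitive of \<open>f t / (1 - t)\<close> solves a linear differential equation of first
  order, so \<open>f\<close> is a multiple of one explicit function (\<open>cesaro_ode\<close>). Hence \<open>w\<close> is an eigenvalue if and only if
  \<open>1 / q < Re (1 / w) < 1 / p\<close> (\<open>eigenvalue_iff\<close>), which is impossible for \<open>2 \<le> p\<close>. For \<open>p = 1\<close> the same functions provide
  arbitrarily large eigenvalues.

  Resolvent. Solving the inhomogeneous equation from the left or from the right end point gives the kernels \<open>volterra_lo\<close>
  and \<open>volterra_up\<close>. Schur's test with a power weight shows that they are bounded if \<open>Re (1 / w)\<close> is less than
  both \<open>1 / p\<close> and \<open>1 / q\<close>, or greater than both, respectively. In these two cases they provide the resolvent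
  (\<open>not_in_spectrum\<close>). The same estimate for the Cesaro kernel itself, which is \<open>volterra_lo 0\<close>, gives the bound
  \<open>max p q\<close> for the norm.

  Spectrum. Between the two lines, boundary included, invertibility fails: for \<open>p < 2\<close> since \<open>w\<close> is a limit of
  eigenvalues, and for \<open>2 \<le> p\<close> since an explicit right-hand side only has solutions that are too singular at one of the
  end points (\<open>cesaro_not_surjective\<close>). At \<open>w = 0\<close> it fails since the range consists of continuous functions.

  Norm. For \<open>p < 2\<close> the eigenvalues approach \<open>q\<close>. For \<open>2 \<le> p\<close> the functions \<open>(1 - t) powr (- a)\<close> with \<open>a\<close> close to \<open>1 / p\<close>
  are almost multiplied by \<open>p\<close> (\<open>cesaro_bound_ge_p\<close>).\<close>

section \<open>Schur's test\<close>

text \<open>The convex function \<open>y powr p\<close> lies above its tangent at \<open>y = l\<close>; this is solved for \<open>y\<close>. Keeping the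
  point \<open>l\<close> free allows an integral to be estimated first and \<open>l\<close> to be optimised afterwards.\<close>

lemma young_tangent:
  fixes p y l :: real
  assumes "1 < p" "0 \<le> y" "0 < l"
  shows "y \<le> l powr (1 - p) / p * y powr p + (1 - 1 / p) * l"
proof -
  define q where "q = p / (p - 1)"
  have q: "q > 1" "1 / p + 1 / q = 1" "1 / q = 1 - 1 / p"
    using assms by (auto simp: q_def field_simps)
  have "y = (y * l powr (- (1 / q))) * l powr (1 / q)"
    using assms by (simp add: powr_minus)
  also have "\<dots> \<le> (y * l powr (- (1 / q))) powr p / p + (l powr (1 / q)) powr q / q"
    using assms q by (intro Youngs_inequality) auto
  also have "(l powr (1 / q)) powr q / q = (1 - 1 / p) * l"
    unfolding q(3)[symmetric] using assms q(1) by (simp add: powr_powr)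
  also have "(y * l powr (- (1 / q))) powr p = y powr p * l powr (- (1 / q) * p)"
    using assms by (simp add: powr_mult powr_powr)
  also have "- (1 / q) * p = 1 - p"
    unfolding q using assms by (simp add: field_simps)
  finally show ?thesis by (simp add: mult_ac)
qed

text \<open>Jensen's inequality for the measure with density \<open>h\<close>: the tangent inequality is integrated against \<open>h\<close>, and \<open>l\<close>
  is chosen such that \<open>l powr p\<close> is the quotient of the two bounds.\<close>

lemma weighted_power_mean:
  fixes h g :: "'a \<Rightarrow> real"
  assumes p: "1 < p" and [measurable]: "h \<in> borel_measurable M" "g \<in> borel_measurable M"
    and nonneg: "\<And>x. x \<in> space M \<Longrightarrow> 0 \<le> h x" "\<And>x. x \<in> space M \<Longrightarrow> 0 \<le> g x"
    and A: "0 < A" "(\<integral>\<^sup>+x. h x \<partial>M) \<le> ennreal A"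
    and X: "0 \<le> X" "(\<integral>\<^sup>+x. h x * g x powr p \<partial>M) \<le> ennreal X"
  shows "(\<integral>\<^sup>+x. h x * g x \<partial>M) < \<infinity>"
    and "enn2real (\<integral>\<^sup>+x. h x * g x \<partial>M) powr p \<le> A powr (p - 1) * X"
proof -
  have bound: "(\<integral>\<^sup>+x. h x * g x \<partial>M) \<le> ennreal (l powr (1 - p) / p * Y + (1 - 1 / p) * l * A)"
    if "0 < l" "0 \<le> Y" "(\<integral>\<^sup>+x. h x * g x powr p \<partial>M) \<le> ennreal Y" for l Y
  proof -
    have "(\<integral>\<^sup>+x. h x * g x \<partial>M) \<le>
        (\<integral>\<^sup>+x. ennreal (l powr (1 - p) / p) * ennreal (h x * g x powr p)
          + ennreal ((1 - 1 / p) * l) * ennreal (h x) \<partial>M)"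
    proof (rule nn_integral_mono)
      fix x assume x: "x \<in> space M"
      have "h x * g x \<le> h x * (l powr (1 - p) / p * g x powr p + (1 - 1 / p) * l)"
        using young_tangent[OF p nonneg(2)[OF x] \<open>0 < l\<close>] nonneg(1)[OF x]
        by (rule mult_left_mono)
      also have "\<dots> = l powr (1 - p) / p * (h x * g x powr p) + (1 - 1 / p) * l * h x"
        by (simp add: algebra_simps)
      finally show "ennreal (h x * g x) \<le> ennreal (l powr (1 - p) / p) * ennreal (h x * g x powr p)
          + ennreal ((1 - 1 / p) * l) * ennreal (h x)"
        using p \<open>0 < l\<close> nonneg[OF x]
        by (simp add: ennreal_leI flip: ennreal_mult ennreal_plus)
    qed
    also have "\<dots> = ennreal (l powr (1 - p) / p) * (\<integral>\<^sup>+x. h x * g x powr p \<partial>M)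
        + ennreal ((1 - 1 / p) * l) * (\<integral>\<^sup>+x. h x \<partial>M)"
      by (subst nn_integral_add, measurable) (simp add: nn_integral_cmult)
    also have "\<dots> \<le> ennreal (l powr (1 - p) / p) * ennreal Y + ennreal ((1 - 1 / p) * l) * ennreal A"
      using that A by (intro add_mono mult_left_mono) auto
    also have "\<dots> = ennreal (l powr (1 - p) / p * Y + (1 - 1 / p) * l * A)"
      using p that A by (simp flip: ennreal_mult ennreal_plus)
    finally show ?thesis .
  qed
  show fin: "(\<integral>\<^sup>+x. h x * g x \<partial>M) < \<infinity>"
    using bound[of 1 X] X by (auto intro: le_less_trans)
  \<comment> \<open>The bound is smallest at \<open>l = (X / A) powr (1 / p)\<close>, which is not positive if \<open>X = 0\<close>;
    hence \<open>X\<close> is enlarged by \<open>e\<close>.\<close>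
  have eps: "enn2real (\<integral>\<^sup>+x. h x * g x \<partial>M) powr p \<le> A powr (p - 1) * (X + e)" if "0 < e" for e
  proof -
    define Y l where "Y = X + e" and "l = (Y / A) powr (1 / p)"
    have Y: "0 < Y" "(\<integral>\<^sup>+x. h x * g x powr p \<partial>M) \<le> ennreal Y"
      using X(1) that order_trans[OF X(2) ennreal_leI, of Y] by (auto simp: Y_def)
    have l: "0 < l" using Y A by (simp add: l_def)
    have lp: "l powr p = Y / A" using Y A p by (simp add: l_def powr_powr)
    have "l powr (1 - p) * Y = l * A"
      using l lp A Y by (simp add: powr_diff field_simps)
    then have "l powr (1 - p) / p * Y + (1 - 1 / p) * l * A = l * A"
      using p by (simp add: field_simps)
    then have "enn2real (\<integral>\<^sup>+x. h x * g x \<partial>M) \<le> l * A"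
      using bound[OF l _ Y(2)] Y l A
      by (metis enn2real_leI less_imp_le mult_nonneg_nonneg)
    then have "enn2real (\<integral>\<^sup>+x. h x * g x \<partial>M) powr p \<le> (l * A) powr p"
      using p by (intro powr_mono2) auto
    also have "\<dots> = Y / A * A powr p" using l A by (simp add: powr_mult lp)
    also have "\<dots> = A powr (p - 1) * Y" using A by (simp add: powr_diff)
    finally show ?thesis by (simp add: Y_def)
  qed
  show "enn2real (\<integral>\<^sup>+x. h x * g x \<partial>M) powr p \<le> A powr (p - 1) * X"
  proof (rule field_le_epsilon)
    fix e :: real assume "0 < e"
    with eps[of "e / A powr (p - 1)"] A
    show "enn2real (\<integral>\<^sup>+x. h x * g x \<partial>M) powr p \<le> A powr (p - 1) * X + e"
      by (simp add: algebra_simps)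
  qed
qed

text \<open>For fixed \<open>x\<close> the inner integral is the mean of \<open>f t / w t\<close> with respect to the density \<open>k x t * w t\<close>, whose mass
  is at most \<open>A * w x\<close>. By Jensen's inequality its \<open>p\<close>-th power is at most \<open>(A * w x) powr (p - 1)\<close> times the mean
  of the \<open>p\<close>-th power. Integrating over \<open>x\<close> and exchanging the integrals leaves the column bound.\<close>

lemma (in sigma_finite_measure) schur_test:
  fixes k :: "'a \<Rightarrow> 'a \<Rightarrow> real" and f w :: "'a \<Rightarrow> real"
  assumes p: "1 < p"
    and k [measurable]: "(\<lambda>(x, t). k x t) \<in> borel_measurable (M \<Otimes>\<^sub>M M)"
    and k0: "\<And>x t. x \<in> space M \<Longrightarrow> t \<in> space M \<Longrightarrow> 0 \<le> k x t"
    and w [measurable]: "w \<in> borel_measurable M" and w0: "\<And>x. x \<in> space M \<Longrightarrow> 0 < w x"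
    and A: "0 < A" "\<And>x. x \<in> space M \<Longrightarrow> (\<integral>\<^sup>+t. k x t * w t \<partial>M) \<le> ennreal (A * w x)"
    and B: "0 \<le> B" "\<And>t. t \<in> space M \<Longrightarrow>
      (\<integral>\<^sup>+x. k x t * w x powr (p - 1) \<partial>M) \<le> ennreal (B * w t powr (p - 1))"
    and f [measurable]: "f \<in> borel_measurable M" and f0: "\<And>x. x \<in> space M \<Longrightarrow> 0 \<le> f x"
    and fin: "(\<integral>\<^sup>+x. f x powr p \<partial>M) < \<infinity>"
  shows "AE x in M. (\<integral>\<^sup>+t. k x t * f t \<partial>M) < \<infinity>"
    and "(\<integral>\<^sup>+x. enn2real (\<integral>\<^sup>+t. k x t * f t \<partial>M) powr p \<partial>M)
      \<le> ennreal (A powr (p - 1) * B) * (\<integral>\<^sup>+x. f x powr p \<partial>M)"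
proof -
  interpret pair_sigma_finite M M ..
  define X where "X x = (\<integral>\<^sup>+t. k x t * w t * (f t / w t) powr p \<partial>M)" for x
  have [measurable]: "X \<in> borel_measurable M" unfolding X_def by measurable
  have "(\<integral>\<^sup>+x. ennreal (w x powr (p - 1)) * X x \<partial>M) =
      (\<integral>\<^sup>+x. \<integral>\<^sup>+t. ennreal (w x powr (p - 1)) * ennreal (k x t * w t * (f t / w t) powr p) \<partial>M \<partial>M)"
    unfolding X_def by (intro nn_integral_cong nn_integral_cmult[symmetric]) measurable
  also have "\<dots> = (\<integral>\<^sup>+t. \<integral>\<^sup>+x. ennreal (w x powr (p - 1)) * ennreal (k x t * w t * (f t / w t) powr p) \<partial>M \<partial>M)"
    by (rule Fubini') measurable
  also have "\<dots> = (\<integral>\<^sup>+t. ennreal (w t * (f t / w t) powr p) * (\<integral>\<^sup>+x. k x t * w x powr (p - 1) \<partial>M) \<partial>M)"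
  proof (rule nn_integral_cong)
    fix t assume t: "t \<in> space M"
    have "(\<integral>\<^sup>+x. ennreal (w x powr (p - 1)) * ennreal (k x t * w t * (f t / w t) powr p) \<partial>M) =
        (\<integral>\<^sup>+x. ennreal (w t * (f t / w t) powr p) * ennreal (k x t * w x powr (p - 1)) \<partial>M)"
      using k0 w0[OF t] t by (intro nn_integral_cong) (simp add: mult_ac flip: ennreal_mult)
    also have "\<dots> = ennreal (w t * (f t / w t) powr p) * (\<integral>\<^sup>+x. k x t * w x powr (p - 1) \<partial>M)"
      using t by (intro nn_integral_cmult) measurable
    finally show "(\<integral>\<^sup>+x. ennreal (w x powr (p - 1)) * ennreal (k x t * w t * (f t / w t) powr p) \<partial>M) = \<dots>" .
  qed
  also have "\<dots> \<le> (\<integral>\<^sup>+t. ennreal (w t * (f t / w t) powr p) * ennreal (B * w t powr (p - 1)) \<partial>M)"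
    using B by (intro nn_integral_mono mult_left_mono) auto
  also have "\<dots> = (\<integral>\<^sup>+t. ennreal B * ennreal (f t powr p) \<partial>M)"
  proof (rule nn_integral_cong)
    fix t assume t: "t \<in> space M"
    have "w t * (f t / w t) powr p * (B * w t powr (p - 1)) = B * f t powr p"
      using w0[OF t] f0[OF t] by (simp add: powr_divide powr_diff field_simps)
    then show "ennreal (w t * (f t / w t) powr p) * ennreal (B * w t powr (p - 1)) = ennreal B * ennreal (f t powr p)"
      using w0[OF t] B by (simp flip: ennreal_mult)
  qed
  also have "\<dots> = ennreal B * (\<integral>\<^sup>+x. f x powr p \<partial>M)" by (rule nn_integral_cmult) measurable
  finally have wX: "(\<integral>\<^sup>+x. ennreal (w x powr (p - 1)) * X x \<partial>M) \<le> ennreal B * (\<integral>\<^sup>+x. f x powr p \<partial>M)" .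
  also have "\<dots> < \<infinity>" using fin by (simp add: ennreal_mult_less_top)
  finally have "AE x in M. ennreal (w x powr (p - 1)) * X x \<noteq> \<infinity>"
    by (intro nn_integral_PInf_AE) auto
  then have finX: "AE x in M. X x < \<infinity>"
  proof (rule AE_mp, intro AE_I2 impI)
    fix x assume "x \<in> space M" "ennreal (w x powr (p - 1)) * X x \<noteq> \<infinity>"
    with w0[of x] show "X x < \<infinity>" by (auto simp: ennreal_mult_eq_top_iff top.not_eq_extremum)
  qed
  have mean: "(\<integral>\<^sup>+t. k x t * f t \<partial>M) < \<infinity> \<and>
      ennreal (enn2real (\<integral>\<^sup>+t. k x t * f t \<partial>M) powr p) \<le> ennreal (A powr (p - 1)) * (ennreal (w x powr (p - 1)) * X x)"
    if x: "x \<in> space M" and "X x < \<infinity>" for x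
  proof -
    have [measurable]: "k x \<in> borel_measurable M" using x by measurable
    have eq: "(\<integral>\<^sup>+t. k x t * f t \<partial>M) = (\<integral>\<^sup>+t. k x t * w t * (f t / w t) \<partial>M)"
      using w0 by (intro nn_integral_cong) (simp add: less_imp_neq[symmetric])
    obtain r where r: "0 \<le> r" "X x = ennreal r" using \<open>X x < \<infinity>\<close> by (cases "X x") auto
    have "(\<integral>\<^sup>+t. k x t * w t * (f t / w t) \<partial>M) < \<infinity> \<and>
        enn2real (\<integral>\<^sup>+t. k x t * w t * (f t / w t) \<partial>M) powr p \<le> (A * w x) powr (p - 1) * r"
      using x w0 k0 A f0 r p
      by (intro conjI weighted_power_mean[where A = "A * w x" and X = r])
        (auto simp: X_def intro!: mult_nonneg_nonneg divide_nonneg_pos less_imp_le[OF w0])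
    with w0[OF x] A r show ?thesis
      unfolding eq by (auto simp: powr_mult mult_ac less_imp_le simp flip: ennreal_mult intro!: ennreal_leI)
  qed
  show "AE x in M. (\<integral>\<^sup>+t. k x t * f t \<partial>M) < \<infinity>"
    using finX by (rule AE_mp) (auto intro!: AE_I2 dest: mean)
  have "(\<integral>\<^sup>+x. enn2real (\<integral>\<^sup>+t. k x t * f t \<partial>M) powr p \<partial>M)
      \<le> (\<integral>\<^sup>+x. ennreal (A powr (p - 1)) * (ennreal (w x powr (p - 1)) * X x) \<partial>M)"
    using finX by (intro nn_integral_mono_AE) (auto intro: AE_mp[OF finX] AE_I2 dest: mean)
  also have "\<dots> = ennreal (A powr (p - 1)) * (\<integral>\<^sup>+x. ennreal (w x powr (p - 1)) * X x \<partial>M)"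
    by (rule nn_integral_cmult) measurable
  also have "\<dots> \<le> ennreal (A powr (p - 1)) * (ennreal B * (\<integral>\<^sup>+x. f x powr p \<partial>M))"
    by (intro mult_left_mono wX) auto
  finally show "(\<integral>\<^sup>+x. enn2real (\<integral>\<^sup>+t. k x t * f t \<partial>M) powr p \<partial>M)
      \<le> ennreal (A powr (p - 1) * B) * (\<integral>\<^sup>+x. f x powr p \<partial>M)"
    using B by (simp add: ennreal_mult mult.assoc)
qed

section \<open>The logit coordinate on the unit interval\<close>

lemma ident_measurable_I01: "(\<lambda>x::real. x) \<in> borel_measurable I01"
  by (rule measurable_restrict_space1) simp

lemma space_I01: "space I01 = {0<..<1}"
  by (simp add: space_restrict_space)

lemma finite_measure_I01: "finite_measure I01"
  by (rule finite_measureI) (simp add: emeasure_restrict_space space_restrict_space)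

interpretation I01: finite_measure I01
  by (rule finite_measure_I01)

interpretation I01_pair: pair_sigma_finite I01 I01 ..

lemma nn_integral_reflect_I01:
  assumes [measurable]: "h \<in> borel_measurable I01"
  shows "(\<integral>\<^sup>+x. h (1 - x) \<partial>I01) = (\<integral>\<^sup>+x. h x \<partial>I01)"
proof -
  have [measurable]: "(\<lambda>x. h x * indicator {0<..<1} x) \<in> borel_measurable borel"
    using assms by (subst (asm) borel_measurable_restrict_space_iff_ennreal) auto
  have "(\<integral>\<^sup>+x. h x \<partial>I01) = (\<integral>\<^sup>+x. h x * indicator {0<..<1} x \<partial>lborel)"
    by (simp add: nn_integral_restrict_space)
  also have "\<dots> = (\<integral>\<^sup>+x. h (1 - x) * indicator {0<..<1} (1 - x) \<partial>lborel)"
    by (subst nn_integral_real_affine[where c = "-1" and t = 1]) auto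
  also have "\<dots> = (\<integral>\<^sup>+x. h (1 - x) * indicator {0<..<1} x \<partial>lborel)"
    by (intro nn_integral_cong) (auto simp: indicator_def)
  also have "\<dots> = (\<integral>\<^sup>+x. h (1 - x) \<partial>I01)"
    by (simp add: nn_integral_restrict_space)
  finally show ?thesis ..
qed

text \<open>Since \<open>exp (logit x) = x / (1 - x)\<close>, this is the logarithm of the half-line coordinate. Its derivative
  \<open>1 / (x * (1 - x))\<close> supplies all the weights below, so that every integral becomes the integral of an exact
  derivative \<open>exp (z * logit x)\<close>.\<close>

definition logit :: "real \<Rightarrow> real" where
  "logit x = ln x - ln (1 - x)"

lemma logit_reflect: "logit (1 - x) = - logit x"
  by (simp add: logit_def)

lemma exp_logit: "0 < x \<Longrightarrow> x < 1 \<Longrightarrow> exp (logit x) = x / (1 - x)"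
  by (simp add: logit_def exp_diff)

lemma logit_measurable [measurable]: "logit \<in> borel_measurable borel"
  unfolding logit_def by measurable

lemma DERIV_logit:
  assumes "0 < x" "x < 1"
  shows "(logit has_real_derivative 1 / (x * (1 - x))) (at x)"
  unfolding logit_def using assms
  by (auto intro!: derivative_eq_intros simp: divide_simps)

lemma continuous_on_logit: "S \<subseteq> {0<..<1} \<Longrightarrow> continuous_on S logit"
  by (auto intro!: continuous_at_imp_continuous_on DERIV_isCont DERIV_logit)

lemma logit_at_0: "filterlim logit at_bot (at_right 0)"
proof -
  have "((\<lambda>x::real. ln (1 - x)) \<longlongrightarrow> ln (1 - 0)) (at_right 0)"
    by (intro tendsto_intros) auto
  moreover have "filterlim (\<lambda>x::real. - ln x) at_top (at_right 0)"
    using ln_at_0 by (simp add: filterlim_uminus_at_bot)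
  ultimately have "filterlim (\<lambda>x::real. ln (1 - x) + - ln x) at_top (at_right 0)"
    by (rule filterlim_tendsto_add_at_top)
  then show ?thesis by (simp add: logit_def[abs_def] filterlim_uminus_at_bot)
qed

lemma has_vector_derivative_exp_logit:
  fixes z :: complex
  assumes "0 < x" "x < 1"
  shows "((\<lambda>x. exp (z * of_real (logit x))) has_vector_derivative
    z * exp (z * of_real (logit x)) / of_real (x * (1 - x))) (at x)"
proof -
  have "((\<lambda>x. complex_of_real (logit x)) has_vector_derivative of_real (1 / (x * (1 - x)))) (at x)"
    using DERIV_logit[OF assms] by (intro has_vector_derivative_of_real) 
  moreover have "((\<lambda>w. exp (z * w)) has_field_derivative z * exp (z * of_real (logit x))) (at (of_real (logit x)))"
    by (auto intro!: derivative_eq_intros)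
  ultimately show ?thesis
    using field_vector_diff_chain_at[of "\<lambda>x. of_real (logit x)"] by (fastforce simp: o_def)
qed

text \<open>The primitive \<open>exp (z * logit t) / z\<close> vanishes at \<open>0\<close> because \<open>Re z > 0\<close> and the logit tends to \<open>-\<infinity>\<close> there. The real
  version comes first, as its nonnegative integrand yields the absolute integrability of the complex one.\<close>

lemma exp_logit_integral_0:
  assumes "0 < Re z" "0 < x" "x < 1"
  shows "set_integrable lborel {0<..<x} (\<lambda>t. exp (z * of_real (logit t)) / of_real (t * (1 - t)))"
    and "(LINT t:{0<..<x}|lborel. exp (z * of_real (logit t)) / of_real (t * (1 - t)))
      = exp (z * of_real (logit x)) / z"
    and "(\<integral>\<^sup>+t. ennreal (if t < x then exp (Re z * logit t) / (t * (1 - t)) else 0) \<partial>I01)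
      = ennreal (exp (Re z * logit x) / Re z)"
proof -
  have isCont_logit: "isCont logit y" if "0 < y" "y < 1" for y
    using DERIV_isCont[OF DERIV_logit[OF that]] .
  have deriv: "DERIV (\<lambda>t. exp (Re z * logit t) / Re z) t :> exp (Re z * logit t) / (t * (1 - t))"
    if "0 < ereal t" "ereal t < ereal x" for t
    using that assms by (auto intro!: derivative_eq_intros DERIV_logit)
  have cont: "isCont (\<lambda>t. exp (Re z * logit t) / (t * (1 - t))) t"
    if "0 < ereal t" "ereal t < ereal x" for t
    using that assms by (auto intro!: continuous_intros isCont_logit)
  have lim_0: "(((\<lambda>t. exp (Re z * logit t) / Re z) \<circ> real_of_ereal) \<longlongrightarrow> 0) (at_right 0)"
    unfolding zero_ereal_def ereal_tendsto_simps
    using assms by (auto intro!: tendsto_divide_zero filterlim_compose[OF exp_at_bot]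
        filterlim_tendsto_pos_mult_at_bot[OF tendsto_const _ logit_at_0])
  have lim_x: "(((\<lambda>t. exp (Re z * logit t) / Re z) \<circ> real_of_ereal) \<longlongrightarrow> exp (Re z * logit x) / Re z) (at_left (ereal x))"
    unfolding ereal_tendsto_simps using assms
    by (intro tendsto_intros tendsto_within_subset[OF isCont_logit[unfolded isCont_def]]) auto
  have real: "set_integrable lborel (einterval 0 x) (\<lambda>t. exp (Re z * logit t) / (t * (1 - t)))"
    "(LBINT t=0..x. exp (Re z * logit t) / (t * (1 - t))) = exp (Re z * logit x) / Re z - 0"
    by (rule interval_integral_FTC_nonneg[OF _ deriv cont _ lim_0 lim_x]; use assms in auto)+
  have eint: "einterval 0 (ereal x) = {0<..<x}"
    by (auto simp: einterval_def zero_ereal_def)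
  have norm_eq: "norm (exp (z * of_real (logit t)) / of_real (t * (1 - t))) = exp (Re z * logit t) / (t * (1 - t))"
    if "t \<in> {0<..<x}" for t
    unfolding norm_divide norm_of_real norm_exp_eq_Re using that assms by simp
  show int: "set_integrable lborel {0<..<x} (\<lambda>t. exp (z * of_real (logit t)) / of_real (t * (1 - t)))"
    unfolding set_integrable_def
  proof (rule Bochner_Integration.integrable_bound)
    show "integrable lborel (\<lambda>t. indicator {0<..<x} t *\<^sub>R (exp (Re z * logit t) / (t * (1 - t))))"
      using real(1) by (simp add: eint set_integrable_def)
    show "AE t in lborel. norm (indicator {0<..<x} t *\<^sub>R (exp (z * of_real (logit t)) / of_real (t * (1 - t))))
      \<le> norm (indicator {0<..<x} t *\<^sub>R (exp (Re z * logit t) / (t * (1 - t))))"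
      using norm_eq assms by (auto simp: indicator_def)
  qed measurable
  have "(LBINT t=0..x. exp (z * of_real (logit t)) / of_real (t * (1 - t))) = exp (z * of_real (logit x)) / z - 0"
  proof (rule interval_integral_FTC_integrable[where F = "\<lambda>t. exp (z * of_real (logit t)) / z"])
    show "((\<lambda>t. exp (z * of_real (logit t)) / z) has_vector_derivative exp (z * of_real (logit t)) / of_real (t * (1 - t))) (at t)"
      if "0 < ereal t" "ereal t < ereal x" for t
      using has_vector_derivative_divide[OF has_vector_derivative_exp_logit[of t z], of z] that assms
      by (cases "z = 0") auto
    show "isCont (\<lambda>t. exp (z * of_real (logit t)) / of_real (t * (1 - t))) t"
      if "0 < ereal t" "ereal t < ereal x" for t
      using that assms by (auto intro!: continuous_intros isCont_logit)
    show "(((\<lambda>t. exp (z * of_real (logit t)) / z) \<circ> real_of_ereal) \<longlongrightarrow> 0) (at_right 0)"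
      unfolding zero_ereal_def ereal_tendsto_simps
    proof (rule tendsto_norm_zero_cancel)
      have "((\<lambda>t. exp (Re z * logit t) / norm z) \<longlongrightarrow> 0) (at_right 0)"
        using assms by (auto intro!: tendsto_divide_zero filterlim_compose[OF exp_at_bot]
          filterlim_tendsto_pos_mult_at_bot[OF tendsto_const _ logit_at_0])
      then show "((\<lambda>t. norm (exp (z * of_real (logit t)) / z)) \<longlongrightarrow> 0) (at_right 0)"
        by (simp add: norm_divide)
    qed
    show "(((\<lambda>t. exp (z * of_real (logit t)) / z) \<circ> real_of_ereal) \<longlongrightarrow> exp (z * of_real (logit x)) / z) (at_left (ereal x))"
      unfolding ereal_tendsto_simps using assms
      by (intro tendsto_intros tendsto_within_subset[OF isCont_logit[unfolded isCont_def]]) auto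
  qed (use assms int in \<open>auto simp: eint zero_ereal_def\<close>)
  then show "(LINT t:{0<..<x}|lborel. exp (z * of_real (logit t)) / of_real (t * (1 - t)))
      = exp (z * of_real (logit x)) / z"
    using assms by (simp add: interval_lebesgue_integral_def eint)
  have "(\<integral>\<^sup>+t. ennreal (if t < x then exp (Re z * logit t) / (t * (1 - t)) else 0) \<partial>I01)
    = (\<integral>\<^sup>+t. ennreal (indicator {0<..<x} t *\<^sub>R (exp (Re z * logit t) / (t * (1 - t)))) \<partial>lborel)"
    unfolding nn_integral_restrict_space[of "{0<..<1::real}" lborel, simplified]
    using assms by (intro nn_integral_cong) (auto simp: indicator_def)
  also have "\<dots> = ennreal (LBINT t. indicator {0<..<x} t *\<^sub>R (exp (Re z * logit t) / (t * (1 - t))))"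
    using real(1) assms by (intro nn_integral_eq_integral AE_I2) (auto simp: eint set_integrable_def indicator_def)
  also have "\<dots> = ennreal (exp (Re z * logit x) / Re z)"
    using real(2) assms by (simp add: interval_lebesgue_integral_def eint set_lebesgue_integral_def)
  finally show "(\<integral>\<^sup>+t. ennreal (if t < x then exp (Re z * logit t) / (t * (1 - t)) else 0) \<partial>I01)
      = ennreal (exp (Re z * logit x) / Re z)" .
qed

declare ident_measurable_I01 [measurable]

lemma exp_logit_integral_1:
  assumes "0 < d" "0 < t" "t < 1"
  shows "(\<integral>\<^sup>+x. ennreal (if t < x then exp (- d * logit x) / (x * (1 - x)) else 0) \<partial>I01)
      = ennreal (exp (- d * logit t) / d)"
proof -
  have "(\<integral>\<^sup>+x. ennreal (if t < x then exp (- d * logit x) / (x * (1 - x)) else 0) \<partial>I01)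
    = (\<integral>\<^sup>+x. ennreal (if t < 1 - x then exp (- d * logit (1 - x)) / ((1 - x) * (1 - (1 - x))) else 0) \<partial>I01)"
    by (rule nn_integral_reflect_I01[symmetric]) measurable
  also have "\<dots> = (\<integral>\<^sup>+x. ennreal (if x < 1 - t then exp (d * logit x) / (x * (1 - x)) else 0) \<partial>I01)"
    by (intro nn_integral_cong) (auto simp: logit_reflect mult.commute)
  also have "\<dots> = ennreal (exp (d * logit (1 - t)) / d)"
    using exp_logit_integral_0(3)[of "of_real d" "1 - t"] assms by (simp cong: if_cong)
  finally show ?thesis by (simp add: logit_reflect)
qed

section \<open>Volterra kernels and their Schur weights\<close>

text \<open>The first-order equation behind \<open>cesaro_fun f = w * f - h\<close> can be solved by integrating either from the left end
  point or from the right one. These are the two solution kernels, with \<open>z = 1 / w\<close>; the kernel of the Cesaro operator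
  is \<open>volterra_lo 0\<close>.\<close>

definition volterra_lo :: "complex \<Rightarrow> real \<Rightarrow> real \<Rightarrow> complex" where
  "volterra_lo z x t =
    (if t < x then exp (z * of_real (logit x - logit t)) / of_real (x * (1 - t)) else 0)"

definition volterra_up :: "complex \<Rightarrow> real \<Rightarrow> real \<Rightarrow> complex" where
  "volterra_up z x t =
    (if x < t then exp (z * of_real (logit x - logit t)) / of_real (x * (1 - t)) else 0)"

definition abs_volterra :: "real \<Rightarrow> real \<Rightarrow> real \<Rightarrow> real" where
  "abs_volterra a x t = (if t < x then exp (a * (logit x - logit t)) / (x * (1 - t)) else 0)"

lemma volterra_measurable [measurable]:
  "(\<lambda>(x, t). volterra_lo z x t) \<in> borel_measurable (I01 \<Otimes>\<^sub>M I01)"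
  "(\<lambda>(x, t). volterra_up z x t) \<in> borel_measurable (I01 \<Otimes>\<^sub>M I01)"
  "(\<lambda>(x, t). abs_volterra a x t) \<in> borel_measurable (I01 \<Otimes>\<^sub>M I01)"
  unfolding volterra_lo_def volterra_up_def abs_volterra_def by measurable

lemma abs_volterra_nonneg: "0 < x \<Longrightarrow> t < 1 \<Longrightarrow> 0 \<le> abs_volterra a x t"
  by (simp add: abs_volterra_def)

lemma norm_volterra_lo:
  "0 < x \<Longrightarrow> t < 1 \<Longrightarrow> norm (volterra_lo z x t) = abs_volterra (Re z) x t"
  unfolding volterra_lo_def abs_volterra_def
  by (auto simp del: of_real_mult simp: norm_divide)

text \<open>The reflection \<open>x \<mapsto> 1 - x\<close> changes the sign of the logit. It exchanges integration from the left with integration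
  from the right and \<open>Re z\<close> with \<open>1 - Re z\<close>, so every estimate is needed for one of the two kernels only.\<close>

lemma norm_volterra_up:
  assumes "x \<in> {0<..<1}" "t \<in> {0<..<1}"
  shows "norm (volterra_up z x t) = abs_volterra (1 - Re z) (1 - x) (1 - t)"
proof -
  have "exp (a * (logit x - logit t)) / (x * (1 - t)) =
      exp ((1 - a) * (logit t - logit x)) / ((1 - x) * t)" for a
  proof -
    have "exp ((1 - a) * (logit t - logit x)) =
        exp (a * (logit x - logit t)) * (exp (logit t) / exp (logit x))"
      by (simp add: algebra_simps flip: exp_add exp_diff)
    also have "exp (logit t) / exp (logit x) = (t * (1 - x)) / (x * (1 - t))"
      using assms by (simp add: exp_logit)
    finally show ?thesis using assms by (simp add: divide_simps)
  qed
  moreover have "norm (exp (z * of_real (logit x - logit t)) / complex_of_real (x * (1 - t)))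
      = exp (Re z * (logit x - logit t)) / (x * (1 - t))"
    unfolding norm_divide norm_of_real norm_exp_eq_Re using assms by simp
  ultimately show ?thesis
    unfolding volterra_up_def abs_volterra_def by (simp add: logit_reflect)
qed

text \<open>In the half-line picture this is the power \<open>u powr (- c)\<close>, which dilation-invariant kernels map to multiples of
  itself; the factor \<open>1 / (1 - x)\<close> is the one that relates functions on the interval to functions on the
  half-line.\<close>

definition schur_weight :: "real \<Rightarrow> real \<Rightarrow> real" where
  "schur_weight c x = exp (- c * logit x) / (1 - x)"

lemma schur_weight_measurable [measurable]: "schur_weight c \<in> borel_measurable borel"
  unfolding schur_weight_def by measurable

lemma schur_weight_pos: "x < 1 \<Longrightarrow> 0 < schur_weight c x"
  by (simp add: schur_weight_def)

lemma schur_weight_row: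
  assumes "a < 1 - c" "0 < x" "x < 1"
  shows "(\<integral>\<^sup>+t. ennreal (abs_volterra a x t * schur_weight c t) \<partial>I01)
    = ennreal (1 / (1 - c - a) * schur_weight c x)"
proof -
  define d where "d = 1 - c - a"
  have "(\<integral>\<^sup>+t. ennreal (abs_volterra a x t * schur_weight c t) \<partial>I01) =
    (\<integral>\<^sup>+t. ennreal (exp (a * logit x) / x) *
      ennreal (if t < x then exp (d * logit t) / (t * (1 - t)) else 0) \<partial>I01)"
  proof (rule nn_integral_cong)
    fix t assume "t \<in> space I01"
    then have t: "0 < t" "t < 1" by (auto simp: space_I01)
    have "exp (d * logit t) = exp (- a * logit t) * exp (- c * logit t) * exp (logit t)"
      by (simp add: d_def algebra_simps flip: exp_add)
    also have "exp (logit t) = t / (1 - t)" using t by (rule exp_logit)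
    finally have d: "exp (d * logit t) = exp (- a * logit t) * exp (- c * logit t) * (t / (1 - t))" .
    have "exp (a * (logit x - logit t)) = exp (a * logit x) * exp (- a * logit t)"
      by (simp add: algebra_simps flip: exp_add)
    then have "exp (a * (logit x - logit t)) / (x * (1 - t)) * (exp (- c * logit t) / (1 - t)) =
        exp (a * logit x) / x * (exp (d * logit t) / (t * (1 - t)))"
      unfolding d using t assms by (simp add: divide_simps)
    then show "ennreal (abs_volterra a x t * schur_weight c t) = ennreal (exp (a * logit x) / x) *
        ennreal (if t < x then exp (d * logit t) / (t * (1 - t)) else 0)"
      using t assms by (simp add: abs_volterra_def schur_weight_def flip: ennreal_mult')
  qed
  also have "\<dots> = ennreal (exp (a * logit x) / x) * ennreal (exp (d * logit x) / d)"
    using exp_logit_integral_0(3)[of "of_real d" x] assms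
    by (subst nn_integral_cmult) (simp_all add: d_def cong: if_cong)
  also have "\<dots> = ennreal (1 / d * schur_weight c x)"
  proof -
    have "exp (d * logit x) = exp (- a * logit x) * exp (- c * logit x) * exp (logit x)"
      by (simp add: d_def algebra_simps flip: exp_add)
    also have "exp (logit x) = x / (1 - x)" using assms by (intro exp_logit)
    finally have d: "exp (d * logit x) = exp (- a * logit x) * exp (- c * logit x) * (x / (1 - x))" .
    have "exp (a * logit x) * exp (- a * logit x) = 1"
      by (simp flip: exp_add)
    then have "exp (a * logit x) / x * (exp (d * logit x) / d) = 1 / d * schur_weight c x"
      unfolding d schur_weight_def using assms by (simp add: divide_simps)
    then show ?thesis
      using assms by (metis ennreal_mult' divide_nonneg_pos exp_ge_zero)
  qed
  finally show ?thesis by (simp add: d_def)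
qed

text \<open>The larger one of \<open>1 / p\<close> and \<open>1 / q\<close>, where \<open>q\<close> is the conjugate exponent. With this exponent the row and the
  column constants of the Schur test agree, which makes the bound for the Cesaro operator sharp.\<close>

definition schur_exponent :: "real \<Rightarrow> real" where
  "schur_exponent p = max (1 / p) (1 - 1 / p)"

text \<open>After taking logarithms, with \<open>X\<close>, \<open>X'\<close>, \<open>T\<close>, \<open>T'\<close> standing for \<open>ln x\<close>, \<open>ln (1 - x)\<close>, \<open>ln t\<close>, \<open>ln (1 - t)\<close>, the two sides
  differ by \<open>(p - 2) * (X - T)\<close> if \<open>2 \<le> p\<close> and by \<open>(2 - p) * (T' - X')\<close> if \<open>p < 2\<close>. In other words, the integrand is
  multiplied by \<open>(x / t) powr (p - 2)\<close> or by \<open>((1 - t) / (1 - x)) powr (2 - p)\<close>, both at least \<open>1\<close>, to make it an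
  exact derivative.\<close>

lemma schur_weight_col_pointwise:
  assumes p: "1 < p" and "0 < t" "t < x" "x < 1"
  defines "c \<equiv> schur_exponent p"
  shows "abs_volterra a x t * schur_weight c x powr (p - 1)
    \<le> schur_weight c t powr (p - 1) * exp ((1 - c - a) * logit t)
      * (exp (- (1 - c - a) * logit x) / (x * (1 - x)))"
proof -
  define X X' T T' where "X = ln x" and "X' = ln (1 - x)" and "T = ln t" and "T' = ln (1 - t)"
  have x: "x = exp X" "1 - x = exp X'" "1 - t = exp T'" and le: "T \<le> X" "X' \<le> T'"
    using assms by (auto simp: X_def X'_def T_def T'_def)
  have logit: "logit x = X - X'" "logit t = T - T'"
    by (simp_all add: logit_def X_def X'_def T_def T'_def)
  have w: "schur_weight c x powr (p - 1) = exp ((p - 1) * (- c * (X - X') - X'))"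
    "schur_weight c t powr (p - 1) = exp ((p - 1) * (- c * (T - T') - T'))"
    unfolding schur_weight_def logit x(2,3)
    by (simp_all add: exp_powr_real mult.commute flip: exp_diff)
  have "abs_volterra a x t = exp (a * ((X - X') - (T - T'))) / (exp X * exp T')"
    using assms by (simp add: abs_volterra_def logit x(3) flip: x(1))
  also have "\<dots> = exp (a * ((X - X') - (T - T')) - X - T')"
    by (simp add: exp_diff)
  finally have "abs_volterra a x t * schur_weight c x powr (p - 1)
      = exp (a * ((X - X') - (T - T')) - X - T' + (p - 1) * (- c * (X - X') - X'))"
    unfolding w by (simp only: exp_add)
  also have "\<dots> \<le> exp ((p - 1) * (- c * (T - T') - T') + (1 - c - a) * (T - T')
      + (- (1 - c - a) * (X - X') - X - X'))"
  proof -
    have "0 \<le> (p * c - 1) * ((X - T) - (X' - T')) + (p - 2) * (X' - T')"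
    proof (cases "p \<ge> 2")
      case True
      have "1 / p \<le> 1 / 2" using True by (intro divide_left_mono) auto
      then have "c = 1 - 1 / p" by (simp add: c_def schur_exponent_def)
      then have pc: "p * c - 1 = p - 2" using p by (simp add: field_simps)
      have "0 \<le> (p - 2) * (X - T)" using True le by simp
      also have "\<dots> = (p - 2) * ((X - T) - (X' - T')) + (p - 2) * (X' - T')"
        by (simp add: algebra_simps)
      finally show ?thesis unfolding pc .
    next
      case False
      have "1 / p \<ge> 1 / 2" using False p by (intro divide_left_mono) auto
      then have "c = 1 / p" by (simp add: c_def schur_exponent_def)
      then have "p * c - 1 = 0" using p by simp
      then show ?thesis using False le by (simp add: mult_nonpos_nonpos)
    qed
    then show ?thesis by (simp add: algebra_simps)
  qed
  also have "\<dots> = exp ((p - 1) * (- c * (T - T') - T')) * exp ((1 - c - a) * (T - T'))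
      * (exp (- (1 - c - a) * (X - X')) / (exp X * exp X'))"
    by (simp only: exp_add exp_diff) simp
  finally show ?thesis
    unfolding w logit x(2) by (simp flip: x(1))
qed

lemma schur_weight_col:
  assumes p: "1 < p" and "0 < t" "t < 1"
  defines "c \<equiv> schur_exponent p"
  assumes "a < 1 - c"
  shows "(\<integral>\<^sup>+x. ennreal (abs_volterra a x t * schur_weight c x powr (p - 1)) \<partial>I01)
    \<le> ennreal (1 / (1 - c - a) * schur_weight c t powr (p - 1))"
proof -
  define d where "d = 1 - c - a"
  have d: "0 < d" using assms by (simp add: d_def)
  have "(\<integral>\<^sup>+x. ennreal (abs_volterra a x t * schur_weight c x powr (p - 1)) \<partial>I01) \<le>
    (\<integral>\<^sup>+x. ennreal (schur_weight c t powr (p - 1) * exp (d * logit t)) *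
      ennreal (if t < x then exp (- d * logit x) / (x * (1 - x)) else 0) \<partial>I01)"
  proof (rule nn_integral_mono)
    fix x assume "x \<in> space I01"
    then show "ennreal (abs_volterra a x t * schur_weight c x powr (p - 1))
      \<le> ennreal (schur_weight c t powr (p - 1) * exp (d * logit t)) *
      ennreal (if t < x then exp (- d * logit x) / (x * (1 - x)) else 0)"
      using schur_weight_col_pointwise[of p t x a] assms
      by (auto simp: space_I01 d_def abs_volterra_def simp flip: ennreal_mult' intro!: ennreal_leI)
  qed
  also have "\<dots> = ennreal (schur_weight c t powr (p - 1) * exp (d * logit t)) *
      ennreal (exp (- d * logit t) / d)"
    unfolding exp_logit_integral_1[OF d \<open>0 < t\<close> \<open>t < 1\<close>, symmetric]
    by (rule nn_integral_cmult) measurable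
  also have "\<dots> = ennreal (1 / d * schur_weight c t powr (p - 1))"
  proof -
    have "exp (d * logit t) * exp (- d * logit t) = 1"
      by (simp flip: exp_add)
    then have eq: "1 / d * schur_weight c t powr (p - 1)
        = schur_weight c t powr (p - 1) * exp (d * logit t) * (exp (- d * logit t) / d)"
      using d by (simp add: divide_simps)
    show ?thesis unfolding eq by (rule ennreal_mult'[symmetric]) simp
  qed
  finally show ?thesis by (simp add: d_def)
qed

section \<open>Kernel operators on p-integrable functions\<close>

definition Lp_fun :: "real \<Rightarrow> (real \<Rightarrow> complex) \<Rightarrow> bool" where
  "Lp_fun p f \<longleftrightarrow> f \<in> borel_measurable I01 \<and> integrable I01 (\<lambda>x. norm (f x) powr p)"

definition Lp_power :: "real \<Rightarrow> (real \<Rightarrow> complex) \<Rightarrow> real" where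
  "Lp_power p f = (\<integral>x. norm (f x) powr p \<partial>I01)"

definition kernel_op :: "(real \<Rightarrow> real \<Rightarrow> complex) \<Rightarrow> (real \<Rightarrow> complex) \<Rightarrow> real \<Rightarrow> complex" where
  "kernel_op k f x = (LINT t|I01. k x t * f t)"

lemma Lp_fun_measurable [measurable_dest]: "Lp_fun p f \<Longrightarrow> f \<in> borel_measurable I01"
  by (simp add: Lp_fun_def)

lemma Lp_power_nonneg: "0 \<le> Lp_power p f"
  by (simp add: Lp_power_def)

lemma nn_integral_Lp_fun:
  "Lp_fun p f \<Longrightarrow> (\<integral>\<^sup>+x. norm (f x) powr p \<partial>I01) = ennreal (Lp_power p f)"
  unfolding Lp_power_def Lp_fun_def by (intro nn_integral_eq_integral) auto

lemma Lp_fun_nn_integral_bound: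
  assumes [measurable]: "f \<in> borel_measurable I01"
    and "(\<integral>\<^sup>+x. norm (f x) powr p \<partial>I01) \<le> ennreal C" "0 \<le> C"
  shows "Lp_fun p f" "Lp_power p f \<le> C"
proof -
  have "integrable I01 (\<lambda>x. norm (f x) powr p)"
    using assms by (intro integrableI_bounded) (auto intro: le_less_trans)
  then show "Lp_fun p f" by (simp add: Lp_fun_def)
  then have "ennreal (Lp_power p f) \<le> ennreal C"
    using assms by (simp add: nn_integral_Lp_fun)
  then show "Lp_power p f \<le> C" using assms by simp
qed

lemma Lp_fun_cmult:
  assumes "Lp_fun p f"
  shows "Lp_fun p (\<lambda>x. c * f x)" "Lp_power p (\<lambda>x. c * f x) = norm c powr p * Lp_power p f"
  using assms by (auto simp: Lp_fun_def Lp_power_def norm_mult powr_mult)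

lemma Lp_fun_add:
  assumes f: "Lp_fun p f" and g: "Lp_fun p g" and p: "0 < p"
  shows "Lp_fun p (\<lambda>x. f x + g x)" "Lp_power p (\<lambda>x. f x + g x) \<le> 2 powr p * (Lp_power p f + Lp_power p g)"
proof -
  note [measurable] = Lp_fun_measurable[OF f] Lp_fun_measurable[OF g]
  have pw: "norm (f x + g x) powr p \<le> 2 powr p * (norm (f x) powr p + norm (g x) powr p)" for x
  proof -
    have "norm (f x + g x) \<le> 2 * max (norm (f x)) (norm (g x))"
      using norm_triangle_ineq[of "f x" "g x"] by simp
    then have "norm (f x + g x) powr p \<le> 2 powr p * max (norm (f x)) (norm (g x)) powr p"
      using p by (subst powr_mult[symmetric]) (auto intro!: powr_mono2)
    also have "\<dots> \<le> 2 powr p * (norm (f x) powr p + norm (g x) powr p)"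
      by (intro mult_left_mono) (auto simp: max_def)
    finally show ?thesis .
  qed
  have int: "integrable I01 (\<lambda>x. 2 powr p * (norm (f x) powr p + norm (g x) powr p))"
    using f g by (auto simp: Lp_fun_def)
  have "integrable I01 (\<lambda>x. norm (f x + g x) powr p)"
    by (rule Bochner_Integration.integrable_bound[OF int]) (use pw in auto)
  then show "Lp_fun p (\<lambda>x. f x + g x)" by (simp add: Lp_fun_def)
  have "Lp_power p (\<lambda>x. f x + g x) \<le> (\<integral>x. 2 powr p * (norm (f x) powr p + norm (g x) powr p) \<partial>I01)"
    unfolding Lp_power_def using int pw
    by (intro integral_mono) (use \<open>integrable I01 (\<lambda>x. norm (f x + g x) powr p)\<close> in auto)
  also have "\<dots> = 2 powr p * (Lp_power p f + Lp_power p g)"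
    using f g by (simp add: Lp_fun_def Lp_power_def)
  finally show "Lp_power p (\<lambda>x. f x + g x) \<le> 2 powr p * (Lp_power p f + Lp_power p g)" .
qed

lemma Lp_fun_bounded:
  assumes [measurable]: "f \<in> borel_measurable I01" and "\<And>x. x \<in> {0<..<1} \<Longrightarrow> norm (f x) \<le> B" "0 \<le> p"
  shows "Lp_fun p f"
  unfolding Lp_fun_def
proof
  show "integrable I01 (\<lambda>x. norm (f x) powr p)"
  proof (rule I01.integrable_const_bound[where B = "B powr p"])
    show "AE x in I01. norm (norm (f x) powr p) \<le> B powr p"
      using assms by (intro AE_I2) (auto simp: space_I01 intro!: powr_mono2)
  qed measurable
qed fact

text \<open>The number \<open>N\<close> bounds the operator norm. The integrability almost everywhere is part of the notion because the
  integral of a function that is not integrable is \<open>0\<close> by convention, so that additivity would fail without it.\<close>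

definition Lp_kernel :: "real \<Rightarrow> real \<Rightarrow> (real \<Rightarrow> real \<Rightarrow> complex) \<Rightarrow> bool" where
  "Lp_kernel p N k \<longleftrightarrow> (\<lambda>(x, t). k x t) \<in> borel_measurable (I01 \<Otimes>\<^sub>M I01) \<and>
    (\<forall>f. Lp_fun p f \<longrightarrow> (AE x in I01. integrable I01 (\<lambda>t. k x t * f t)) \<and>
      Lp_fun p (kernel_op k f) \<and> Lp_power p (kernel_op k f) \<le> N powr p * Lp_power p f)"

lemma kernel_op_measurable:
  assumes [measurable]: "(\<lambda>(x, t). k x t) \<in> borel_measurable (I01 \<Otimes>\<^sub>M I01)" "f \<in> borel_measurable I01"
  shows "kernel_op k f \<in> borel_measurable I01"
  unfolding kernel_op_def by measurable

lemma kernel_op_cong_AE: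
  assumes [measurable]: "(\<lambda>(x, t). k x t) \<in> borel_measurable (I01 \<Otimes>\<^sub>M I01)"
    and "ae_eq f g" "x \<in> {0<..<1}"
  shows "kernel_op k f x = kernel_op k g x"
proof -
  have [measurable]: "f \<in> borel_measurable I01" "g \<in> borel_measurable I01" "k x \<in> borel_measurable I01"
    using assms by (auto simp: ae_eq_def space_I01 intro: measurable_Pair2[of "\<lambda>(x, t). k x t", simplified])
  show ?thesis
    unfolding kernel_op_def using assms by (intro integral_cong_AE) (auto simp: ae_eq_def)
qed

lemma Lp_kernel_schur:
  assumes p: "1 < p"
    and k [measurable]: "(\<lambda>(x, t). k x t) \<in> borel_measurable (I01 \<Otimes>\<^sub>M I01)"
    and s [measurable]: "(\<lambda>(x, t). s x t) \<in> borel_measurable (I01 \<Otimes>\<^sub>M I01)"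
    and ks: "\<And>x t. x \<in> {0<..<1} \<Longrightarrow> t \<in> {0<..<1} \<Longrightarrow> norm (k x t) \<le> s x t"
    and w: "w \<in> borel_measurable I01" "\<And>x. x \<in> {0<..<1} \<Longrightarrow> 0 < w x"
    and N: "0 < N"
    and row: "\<And>x. x \<in> {0<..<1} \<Longrightarrow> (\<integral>\<^sup>+t. s x t * w t \<partial>I01) \<le> ennreal (N * w x)"
    and col: "\<And>t. t \<in> {0<..<1} \<Longrightarrow>
      (\<integral>\<^sup>+x. s x t * w x powr (p - 1) \<partial>I01) \<le> ennreal (N * w t powr (p - 1))"
  shows "Lp_kernel p N k"
  unfolding Lp_kernel_def
proof (intro conjI allI impI k)
  fix f assume f: "Lp_fun p f"
  then have [measurable]: "f \<in> borel_measurable I01" by measurable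
  have s0: "0 \<le> s x t" if "x \<in> {0<..<1}" "t \<in> {0<..<1}" for x t
    using ks[OF that] norm_ge_zero order_trans by blast
  have "(\<integral>\<^sup>+x. norm (f x) powr p \<partial>I01) < \<infinity>"
    using f by (simp add: nn_integral_Lp_fun)
  note schur = I01.schur_test[OF p s _ w(1) _ N _ less_imp_le[OF N], of "\<lambda>x. norm (f x)",
      OF _ _ _ _ _ norm_ge_zero this]
  have fin: "AE x in I01. (\<integral>\<^sup>+t. s x t * norm (f t) \<partial>I01) < \<infinity>"
    by (rule schur(1)) (use s0 w row col in \<open>simp_all add: space_I01\<close>)
  have bound: "(\<integral>\<^sup>+x. enn2real (\<integral>\<^sup>+t. s x t * norm (f t) \<partial>I01) powr p \<partial>I01)
      \<le> ennreal (N powr (p - 1) * N) * ennreal (Lp_power p f)"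
    unfolding nn_integral_Lp_fun[OF f, symmetric]
    by (rule schur(2)) (use s0 w row col in \<open>simp_all add: space_I01\<close>)
  have dom: "(\<integral>\<^sup>+t. norm (k x t * f t) \<partial>I01) \<le> (\<integral>\<^sup>+t. s x t * norm (f t) \<partial>I01)" if "x \<in> {0<..<1}" for x
    using that ks s0 by (intro nn_integral_mono ennreal_leI) (auto simp: space_I01 norm_mult intro!: mult_right_mono)
  have kx [measurable]: "k x \<in> borel_measurable I01" if "x \<in> {0<..<1}" for x
    using that measurable_Pair2[OF k, of x] by (simp add: space_I01)
  have int: "AE x in I01. integrable I01 (\<lambda>t. k x t * f t)"
    using fin
  proof (rule AE_mp, intro AE_I2 impI)
    fix x assume x: "x \<in> space I01" "(\<integral>\<^sup>+t. s x t * norm (f t) \<partial>I01) < \<infinity>"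
    then have [measurable]: "k x \<in> borel_measurable I01" by (intro kx) (simp add: space_I01)
    show "integrable I01 (\<lambda>t. k x t * f t)"
      using dom[of x] x by (intro integrableI_bounded) (auto simp: space_I01 intro: le_less_trans)
  qed
  then show "AE x in I01. integrable I01 (\<lambda>t. k x t * f t)" .
  have le: "AE x in I01. norm (kernel_op k f x) \<le> enn2real (\<integral>\<^sup>+t. s x t * norm (f t) \<partial>I01)"
    using int fin AE_space
  proof eventually_elim
    case (elim x)
    have "ennreal (norm (kernel_op k f x)) \<le> (\<integral>\<^sup>+t. norm (k x t * f t) \<partial>I01)"
      unfolding kernel_op_def using elim by (intro integral_norm_bound_ennreal)
    also have "\<dots> \<le> (\<integral>\<^sup>+t. s x t * norm (f t) \<partial>I01)"
      using elim by (intro dom) (simp add: space_I01)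
    finally show ?case
      using elim by (metis enn2real_mono enn2real_ennreal norm_ge_zero infinity_ennreal_def)
  qed
  have "(\<integral>\<^sup>+x. norm (kernel_op k f x) powr p \<partial>I01) \<le>
      (\<integral>\<^sup>+x. enn2real (\<integral>\<^sup>+t. s x t * norm (f t) \<partial>I01) powr p \<partial>I01)"
    using le p by (intro nn_integral_mono_AE) (auto elim!: eventually_mono intro!: ennreal_leI powr_mono2)
  also note bound
  also have "ennreal (N powr (p - 1) * N) * ennreal (Lp_power p f) = ennreal (N powr p * Lp_power p f)"
    using N by (simp add: powr_diff Lp_power_nonneg flip: ennreal_mult)
  finally have "(\<integral>\<^sup>+x. norm (kernel_op k f x) powr p \<partial>I01) \<le> ennreal (N powr p * Lp_power p f)" .
  then show "Lp_fun p (kernel_op k f)" "Lp_power p (kernel_op k f) \<le> N powr p * Lp_power p f"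
    by (rule Lp_fun_nn_integral_bound[rotated]; simp add: Lp_power_nonneg kernel_op_measurable)+
qed

lemma Lp_kernel_dominated_lo:
  assumes "1 < p" "a < 1 - schur_exponent p"
    and "(\<lambda>(x, t). k x t) \<in> borel_measurable (I01 \<Otimes>\<^sub>M I01)"
    and "\<And>x t. x \<in> {0<..<1} \<Longrightarrow> t \<in> {0<..<1} \<Longrightarrow> norm (k x t) \<le> abs_volterra a x t"
  shows "Lp_kernel p (1 / (1 - schur_exponent p - a)) k"
  using assms
  by (intro Lp_kernel_schur[where s = "abs_volterra a" and w = "schur_weight (schur_exponent p)"])
    (auto simp: schur_weight_row schur_weight_pos intro!: schur_weight_col[simplified])

lemma Lp_kernel_dominated_up:
  assumes p: "1 < p" and a: "a < 1 - schur_exponent p"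
    and "(\<lambda>(x, t). k x t) \<in> borel_measurable (I01 \<Otimes>\<^sub>M I01)"
    and "\<And>x t. x \<in> {0<..<1} \<Longrightarrow> t \<in> {0<..<1} \<Longrightarrow> norm (k x t) \<le> abs_volterra a (1 - x) (1 - t)"
  shows "Lp_kernel p (1 / (1 - schur_exponent p - a)) k"
proof (rule Lp_kernel_schur[where s = "\<lambda>x t. abs_volterra a (1 - x) (1 - t)"
      and w = "\<lambda>x. schur_weight (schur_exponent p) (1 - x)"])
  show "(\<lambda>(x, t). abs_volterra a (1 - x) (1 - t)) \<in> borel_measurable (I01 \<Otimes>\<^sub>M I01)"
    unfolding abs_volterra_def by measurable
  fix x :: real assume x: "x \<in> {0<..<1}"
  let ?w = "schur_weight (schur_exponent p)"
  have [measurable]: "(\<lambda>t. abs_volterra a (1 - x) t) \<in> borel_measurable I01"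
    "(\<lambda>t. abs_volterra a t (1 - x)) \<in> borel_measurable I01"
    unfolding abs_volterra_def by measurable
  show "(\<integral>\<^sup>+t. abs_volterra a (1 - x) (1 - t) * ?w (1 - t) \<partial>I01)
      \<le> ennreal (1 / (1 - schur_exponent p - a) * ?w (1 - x))"
    using schur_weight_row[OF a, of "1 - x"] x
    by (subst nn_integral_reflect_I01[where h = "\<lambda>t. ennreal (abs_volterra a (1 - x) t * ?w t)"]) auto
  show "(\<integral>\<^sup>+t. abs_volterra a (1 - t) (1 - x) * ?w (1 - t) powr (p - 1) \<partial>I01)
      \<le> ennreal (1 / (1 - schur_exponent p - a) * ?w (1 - x) powr (p - 1))"
    using schur_weight_col[OF p _ _ a, of "1 - x"] x
    by (subst nn_integral_reflect_I01[where h = "\<lambda>t. ennreal (abs_volterra a t (1 - x) * ?w t powr (p - 1))"]) auto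
qed (use assms in \<open>auto simp: schur_weight_pos\<close>)

section \<open>Composition with the Cesaro operator\<close>

text \<open>The kernels \<open>norm (k1 x t)\<close> and \<open>norm (k2 x t)\<close> are applied to \<open>norm (f t)\<close>: the outcome is finite almost everywhere,
  which is the absolute convergence that Fubini's theorem asks for.\<close>

lemma kernel_op_compose:
  assumes k1 [measurable]: "(\<lambda>(x, t). k1 x t) \<in> borel_measurable (I01 \<Otimes>\<^sub>M I01)"
    and k2 [measurable]: "(\<lambda>(x, t). k2 x t) \<in> borel_measurable (I01 \<Otimes>\<^sub>M I01)"
    and abs1: "Lp_kernel p N1 (\<lambda>x t. of_real (norm (k1 x t)))"
    and abs2: "Lp_kernel p N2 (\<lambda>x t. of_real (norm (k2 x t)))"
    and f: "Lp_fun p f"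
  shows "AE x in I01. kernel_op k1 (kernel_op k2 f) x = (LINT t|I01. (LINT y|I01. k1 x y * k2 y t) * f t)"
proof -
  note [measurable] = Lp_fun_measurable[OF f]
  define f' :: "real \<Rightarrow> complex" where "f' = (\<lambda>x. of_real (norm (f x)))"
  define g where "g y = (LINT t|I01. norm (k2 y t) * norm (f t))" for y
  have f': "Lp_fun p f'"
    using f by (simp add: f'_def Lp_fun_def)
  have g: "kernel_op (\<lambda>x t. of_real (norm (k2 x t))) f' = (\<lambda>y. of_real (g y))"
    unfolding kernel_op_def f'_def g_def of_real_mult[symmetric] integral_complex_of_real ..
  have "Lp_fun p (\<lambda>y. of_real (g y))"
    using abs2 f' unfolding Lp_kernel_def g[symmetric] by blast
  then have "AE x in I01. integrable I01 (\<lambda>y. of_real (norm (k1 x y)) * of_real (g y) :: complex)"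
    using abs1 unfolding Lp_kernel_def by blast
  then have int1: "AE x in I01. integrable I01 (\<lambda>y. norm (k1 x y) * g y)"
    unfolding of_real_mult[symmetric] complex_of_real_integrable_eq .
  have "AE y in I01. integrable I01 (\<lambda>t. of_real (norm (k2 y t)) * f' t)"
    using abs2 f' unfolding Lp_kernel_def by blast
  then have int2: "AE y in I01. integrable I01 (\<lambda>t. k2 y t * f t)"
    using AE_space
  proof eventually_elim
    case (elim y)
    from measurable_Pair2[OF k2 elim(2)] have [measurable]: "k2 y \<in> borel_measurable I01" by simp
    show ?case
      by (rule Bochner_Integration.integrable_bound[OF elim(1)]) (simp_all add: f'_def norm_mult)
  qed
  from int1 AE_space show ?thesis
  proof eventually_elim
    case (elim x)
    from measurable_Pair2[OF k1 elim(2)] have [measurable]: "k1 x \<in> borel_measurable I01" by simp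
    have int: "integrable (I01 \<Otimes>\<^sub>M I01) (\<lambda>(y, t). k1 x y * (k2 y t * f t))"
    proof (rule I01_pair.Fubini_integrable)
      show "integrable I01 (\<lambda>y. LINT t|I01. norm (case (y, t) of (y, t) \<Rightarrow> k1 x y * (k2 y t * f t)))"
        using elim(1) by (simp add: norm_mult g_def)
      show "AE y in I01. integrable I01 (\<lambda>t. case (y, t) of (y, t) \<Rightarrow> k1 x y * (k2 y t * f t))"
        using int2 by eventually_elim simp
    qed measurable
    have "kernel_op k1 (kernel_op k2 f) x = (LINT y|I01. LINT t|I01. k1 x y * (k2 y t * f t))"
      by (simp add: kernel_op_def)
    also have "\<dots> = (LINT t|I01. LINT y|I01. k1 x y * (k2 y t * f t))"
      using I01_pair.Fubini_integral[OF int] by simp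
    also have "\<dots> = (LINT t|I01. (LINT y|I01. k1 x y * k2 y t) * f t)"
      by (simp flip: mult.assoc)
    finally show ?case .
  qed
qed

lemma cesaro_fun_eq_kernel_op:
  assumes "x \<in> {0<..<1}"
  shows "cesaro_fun f x = kernel_op (volterra_lo 0) f x"
proof -
  have "cesaro_fun f x = (LINT t|I01. 1 / of_real x * (indicator {0<..<x} t *\<^sub>R (f t / (1 - of_real t))))"
    using assms by (simp only: cesaro_fun_eq_I01 greaterThanLessThan_iff integral_mult_right_zero)
  also have "\<dots> = kernel_op (volterra_lo 0) f x"
    unfolding kernel_op_def
    by (intro Bochner_Integration.integral_cong)
      (auto simp: space_I01 volterra_lo_def indicator_def)
  finally show ?thesis .
qed

lemma LINT_I01: "(LINT t|I01. f t) = (LINT t|lborel. indicator {0<..<1} t *\<^sub>R f t)"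
  for f :: "real \<Rightarrow> complex"
  by (simp add: integral_restrict_space)

lemma exp_logit_diff:
  "exp (z * (of_real (logit y) - of_real (logit t))) = exp (z * of_real (logit y)) * exp (- (z * of_real (logit t)))"
  for z :: complex
  by (simp add: algebra_simps flip: exp_add)

text \<open>On \<open>{t<..<x}\<close> the product of the kernels is a multiple of the derivative of \<open>exp (z * logit y) / z\<close>, and its two
  boundary values are the two kernels on the right. On the level of operators, with \<open>w = 1 / z\<close>, \<open>T\<close> for the Cesaro
  operator and \<open>L\<close> for \<open>volterra_lo z\<close>, this reads \<open>T L = w (L - T)\<close>.\<close>

lemma volterra_compose_lo:
  assumes x: "x \<in> {0<..<1}" and t: "t \<in> {0<..<1}" and z: "z \<noteq> 0"
  shows "(LINT y|I01. volterra_lo 0 x y * volterra_lo z y t) =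
    (volterra_lo z x t - volterra_lo 0 x t) / z"
proof (cases "t < x")
  case True
  define P where "P = complex_of_real (x * (1 - t))"
  define C where "C = exp (- (z * of_real (logit t))) / P"
  define E where "E y = exp (z * of_real (logit y)) / of_real (y * (1 - y))" for y
  have pw: "volterra_lo 0 x y * volterra_lo z y t = C * E y" if "y \<in> {t<..<x}" for y
    using x t True that
    by (simp add: volterra_lo_def C_def E_def P_def exp_logit_diff mult_ac)
  have "(LINT y|I01. volterra_lo 0 x y * volterra_lo z y t) =
      (LINT y|lborel. C * (indicator {t<..<x} y *\<^sub>R E y))"
    unfolding LINT_I01
  proof (intro Bochner_Integration.integral_cong refl)
    fix y :: real
    have "volterra_lo 0 x y * volterra_lo z y t = 0" if "y \<notin> {t<..<x}"
      using that by (auto simp: volterra_lo_def)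
    then show "indicator {0<..<1} y *\<^sub>R (volterra_lo 0 x y * volterra_lo z y t) =
        C * (indicator {t<..<x} y *\<^sub>R E y)"
      using pw[of y] x t by (cases "y \<in> {t<..<x}") auto
  qed
  also have "\<dots> = C * (LINT y:{t<..<x}|lborel. E y)"
    by (simp only: set_lebesgue_integral_def integral_mult_right_zero)
  also have "(LINT y:{t<..<x}|lborel. E y) = (LBINT y=t..x. E y)"
    using True by (simp add: interval_lebesgue_integral_def einterval_eq)
  also have "\<dots> = exp (z * of_real (logit x)) / z - exp (z * of_real (logit t)) / z"
  proof (rule interval_integral_FTC_finite)
    show "((\<lambda>y. exp (z * of_real (logit y)) / z) has_vector_derivative E y)
        (at y within {min t x..max t x})" if "min t x \<le> y" "y \<le> max t x" for y
      using has_vector_derivative_divide[OF has_vector_derivative_exp_logit[of y z], of z] that x t z True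
      by (auto simp: E_def intro: has_vector_derivative_at_within)
    show "continuous_on {min t x..max t x} E"
      unfolding E_def using x t True by (intro continuous_intros continuous_on_logit) auto
  qed
  also have "C * \<dots> = (volterra_lo z x t - volterra_lo 0 x t) / z"
  proof -
    have "exp (z * of_real (logit t)) * exp (- (z * of_real (logit t))) = 1"
      by (simp flip: exp_add)
    moreover have "volterra_lo z x t = exp (z * of_real (logit x)) * C" "volterra_lo 0 x t = 1 / P"
      using True by (simp_all add: volterra_lo_def exp_logit_diff C_def P_def)
    ultimately show ?thesis
      by (simp add: C_def diff_divide_distrib right_diff_distrib mult_ac)
  qed
  finally show ?thesis .
next
  case False
  then show ?thesis
    by (auto simp: volterra_lo_def intro!: integral_eq_zero_AE)
qed

text \<open>Now \<open>y\<close> ranges over \<open>{0<..<min x t}\<close>, and only the upper boundary value survives. It belongs to one kernel or the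
  other according to which of \<open>x\<close> and \<open>t\<close> is smaller. On the level of operators this reads \<open>T U = w (U + T)\<close>.\<close>

lemma volterra_compose_up:
  assumes x: "x \<in> {0<..<1}" and t: "t \<in> {0<..<1}" and z: "0 < Re z" and ne: "t \<noteq> x"
  shows "(LINT y|I01. volterra_lo 0 x y * volterra_up z y t) =
    (volterra_lo 0 x t + volterra_up z x t) / z"
proof -
  define P where "P = complex_of_real (x * (1 - t))"
  define C where "C = exp (- (z * of_real (logit t))) / P"
  define m where "m = min x t"
  define E where "E y = exp (z * of_real (logit y)) / of_real (y * (1 - y))" for y
  have z0: "z \<noteq> 0" using z by auto
  have pw: "volterra_lo 0 x y * volterra_up z y t = C * E y" if "y \<in> {0<..<m}" for y
    using x t that
    by (simp add: volterra_lo_def volterra_up_def C_def E_def m_def P_def exp_logit_diff mult_ac)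
  have "(LINT y|I01. volterra_lo 0 x y * volterra_up z y t) =
      (LINT y|lborel. C * (indicator {0<..<m} y *\<^sub>R E y))"
    unfolding LINT_I01
  proof (intro Bochner_Integration.integral_cong refl)
    fix y :: real
    have "volterra_lo 0 x y * volterra_up z y t = 0" if "\<not> y < m"
      using that by (auto simp: volterra_lo_def volterra_up_def m_def)
    then show "indicator {0<..<1} y *\<^sub>R (volterra_lo 0 x y * volterra_up z y t) =
        C * (indicator {0<..<m} y *\<^sub>R E y)"
      using pw[of y] x t by (cases "y \<in> {0<..<m}") (auto simp: m_def)
  qed
  also have "\<dots> = C * (LINT y:{0<..<m}|lborel. E y)"
    by (simp only: set_lebesgue_integral_def integral_mult_right_zero)
  also have "(LINT y:{0<..<m}|lborel. E y) = exp (z * of_real (logit m)) / z"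
    unfolding E_def using z x t by (intro exp_logit_integral_0) (auto simp: m_def)
  also have "C * \<dots> = (volterra_lo 0 x t + volterra_up z x t) / z"
  proof (cases "t < x")
    case True
    have "exp (z * of_real (logit t)) * exp (- (z * of_real (logit t))) = 1"
      by (simp flip: exp_add)
    moreover have "volterra_up z x t = 0" "volterra_lo 0 x t = 1 / P" "m = t"
      using True by (simp_all add: volterra_lo_def volterra_up_def m_def P_def)
    ultimately show ?thesis by (simp add: C_def mult_ac)
  next
    case False
    then have "volterra_up z x t = exp (z * of_real (logit x)) * C" "volterra_lo 0 x t = 0" "m = x"
      using ne by (simp_all add: volterra_lo_def volterra_up_def m_def exp_logit_diff C_def P_def)
    then show ?thesis by simp
  qed
  finally show ?thesis .
qed

lemma cesaro_fun_linear:
  assumes f: "Lp_fun p f" and g: "Lp_fun p g" and p: "1 \<le> p" and x: "x \<in> {0<..<1}"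
  shows "cesaro_fun (\<lambda>x. a * f x + b * g x) x = a * cesaro_fun f x + b * cesaro_fun g x"
proof -
  have int: "set_integrable lborel {0<..<x} (\<lambda>t. h t / (1 - of_real t))" if "Lp_fun p h" for h
    using cesaro_integrable[of h p x] that p x by (simp add: Lp_fun_def)
  have "(LINT t:{0<..<x}|lborel. (a * f t + b * g t) / (1 - of_real t)) =
      (LINT t:{0<..<x}|lborel. a * (f t / (1 - of_real t)) + b * (g t / (1 - of_real t)))"
    by (simp add: add_divide_distrib)
  also have "\<dots> = a * (LINT t:{0<..<x}|lborel. f t / (1 - of_real t)) + b * (LINT t:{0<..<x}|lborel. g t / (1 - of_real t))"
    using int[OF f] int[OF g]
    by (subst set_integral_add) (simp_all del: times_divide_eq_right)
  finally show ?thesis by (simp add: cesaro_fun_def algebra_simps add_divide_distrib)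
qed

lemma schur_exponent_bounds: "1 < p \<Longrightarrow> 0 < schur_exponent p \<and> schur_exponent p < 1"
  by (auto simp: schur_exponent_def less_max_iff_disj)

lemma Lp_kernel_volterra_lo:
  assumes "1 < p" "Re z < 1 - schur_exponent p"
  shows "Lp_kernel p (1 / (1 - schur_exponent p - Re z)) (volterra_lo z)"
    and "Lp_kernel p (1 / (1 - schur_exponent p - Re z)) (\<lambda>x t. of_real (norm (volterra_lo z x t)))"
  using assms by (auto intro!: Lp_kernel_dominated_lo simp: norm_volterra_lo abs_volterra_nonneg)

lemma Lp_kernel_volterra_up:
  assumes "1 < p" "schur_exponent p < Re z"
  shows "Lp_kernel p (1 / (Re z - schur_exponent p)) (volterra_up z)"
    and "Lp_kernel p (1 / (Re z - schur_exponent p)) (\<lambda>x t. of_real (norm (volterra_up z x t)))"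
  using assms Lp_kernel_dominated_up[of p "1 - Re z"]
  by (auto simp: norm_volterra_up abs_volterra_nonneg)

lemma cesaro_fun_Lp:
  assumes p: "1 < p" and f: "Lp_fun p f"
  shows "Lp_fun p (cesaro_fun f)"
    and "Lp_power p (cesaro_fun f) \<le> (1 / (1 - schur_exponent p)) powr p * Lp_power p f"
proof -
  have k: "Lp_kernel p (1 / (1 - schur_exponent p)) (volterra_lo 0)"
    using Lp_kernel_volterra_lo(1)[of p 0] p schur_exponent_bounds[OF p] by simp
  have eq: "norm (cesaro_fun f x) powr p = norm (kernel_op (volterra_lo 0) f x) powr p" if "x \<in> space I01" for x
    using that by (simp add: cesaro_fun_eq_kernel_op space_I01)
  have "cesaro_fun f \<in> borel_measurable I01"
    using f by (intro measurable_cesaro_fun) (simp add: Lp_fun_def)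
  then show "Lp_fun p (cesaro_fun f)"
    using k f Bochner_Integration.integrable_cong[OF refl eq, of I01]
    unfolding Lp_kernel_def Lp_fun_def by auto
  show "Lp_power p (cesaro_fun f) \<le> (1 / (1 - schur_exponent p)) powr p * Lp_power p f"
    using k f Bochner_Integration.integral_cong[OF refl eq, of I01]
    unfolding Lp_kernel_def Lp_power_def by auto
qed

text \<open>The kernel is \<open>volterra_lo (1 / z)\<close> or \<open>- volterra_up (1 / z)\<close>. With this sign both satisfy the same relation
  \<open>T k = z (k - T)\<close>.\<close>

lemma resolvent_kernel_exists:
  assumes p: "1 < p" and z: "z \<noteq> 0"
    and re: "Re (1 / z) < 1 - schur_exponent p \<or> schur_exponent p < Re (1 / z)"
  obtains N k where "Lp_kernel p N k"
    "\<And>f. Lp_fun p f \<Longrightarrow> AE x in I01. cesaro_fun (kernel_op k f) x = z * (kernel_op k f x - cesaro_fun f x)"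
proof -
  define w where "w = 1 / z"
  have w: "w \<noteq> 0" "1 / w = z" using z by (auto simp: w_def)
  have k0: "0 < schur_exponent p" "Re 0 < 1 - schur_exponent p"
    using schur_exponent_bounds[OF p] by auto
  note lo0 = Lp_kernel_volterra_lo[OF p k0(2)]
  from re show ?thesis
  proof
    assume "Re (1 / z) < 1 - schur_exponent p"
    then have re: "Re w < 1 - schur_exponent p" by (simp add: w_def)
    note lo = Lp_kernel_volterra_lo[OF p re]
    show ?thesis
    proof (rule that[OF lo(1)])
      fix f assume f: "Lp_fun p f"
      have "AE x in I01. integrable I01 (\<lambda>t. volterra_lo 0 x t * f t)"
        "AE x in I01. integrable I01 (\<lambda>t. volterra_lo w x t * f t)"
        using lo0(1) lo(1) f by (auto simp: Lp_kernel_def)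
      with kernel_op_compose[OF volterra_measurable(1) volterra_measurable(1) lo0(2) lo(2) f]
      show "AE x in I01. cesaro_fun (kernel_op (volterra_lo w) f) x =
          z * (kernel_op (volterra_lo w) f x - cesaro_fun f x)"
        using AE_space
      proof eventually_elim
        case (elim x)
        then have x: "x \<in> {0<..<1}" by (simp add: space_I01)
        have "cesaro_fun (kernel_op (volterra_lo w) f) x =
            (LINT t|I01. (LINT y|I01. volterra_lo 0 x y * volterra_lo w y t) * f t)"
          using elim(1) x by (simp add: cesaro_fun_eq_kernel_op)
        also have "\<dots> = (LINT t|I01. z * (volterra_lo w x t * f t - volterra_lo 0 x t * f t))"
          using x w by (intro Bochner_Integration.integral_cong refl)
            (simp add: volterra_compose_lo space_I01 w_def algebra_simps)
        also have "\<dots> = z * (kernel_op (volterra_lo w) f x - kernel_op (volterra_lo 0) f x)"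
          unfolding kernel_op_def using elim(2,3) by simp
        finally show ?case using x by (simp add: cesaro_fun_eq_kernel_op)
      qed
    qed
  next
    assume "schur_exponent p < Re (1 / z)"
    then have re: "schur_exponent p < Re w" by (simp add: w_def)
    note up = Lp_kernel_volterra_up[OF p re]
    have neg: "kernel_op (\<lambda>x t. - volterra_up w x t) f = (\<lambda>x. - kernel_op (volterra_up w) f x)" for f
      by (simp add: kernel_op_def fun_eq_iff)
    have Lp_neg: "Lp_kernel p (1 / (Re w - schur_exponent p)) (\<lambda>x t. - volterra_up w x t)"
      using up(1) unfolding Lp_kernel_def neg
      using Lp_fun_cmult[where c = "-1"] by (auto simp: case_prod_beta intro!: borel_measurable_uminus)
    show ?thesis
    proof (rule that[OF Lp_neg])
      fix f assume f: "Lp_fun p f"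
      note [measurable] = Lp_fun_measurable[OF f]
      have "AE x in I01. integrable I01 (\<lambda>t. volterra_lo 0 x t * f t)"
        "AE x in I01. integrable I01 (\<lambda>t. volterra_up w x t * f t)"
        using lo0(1) up(1) f by (auto simp: Lp_kernel_def)
      with kernel_op_compose[OF volterra_measurable(1) volterra_measurable(2) lo0(2) up(2) f]
      show "AE x in I01. cesaro_fun (kernel_op (\<lambda>x t. - volterra_up w x t) f) x =
          z * (kernel_op (\<lambda>x t. - volterra_up w x t) f x - cesaro_fun f x)"
        using AE_space
      proof eventually_elim
        case (elim x)
        then have x: "x \<in> {0<..<1}" by (simp add: space_I01)
        have [measurable]: "volterra_lo 0 x \<in> borel_measurable I01" "volterra_up w x \<in> borel_measurable I01"
          using measurable_Pair2[OF volterra_measurable(1) elim(4)] measurable_Pair2[OF volterra_measurable(2) elim(4)]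
          by simp_all
        have "cesaro_fun (kernel_op (\<lambda>x t. - volterra_up w x t) f) x =
            - (LINT t|I01. (LINT y|I01. volterra_lo 0 x y * volterra_up w y t) * f t)"
          unfolding neg using elim(1) x by (simp add: cesaro_fun_eq_kernel_op kernel_op_def)
        also have "(LINT t|I01. (LINT y|I01. volterra_lo 0 x y * volterra_up w y t) * f t)
            = (LINT t|I01. z * (volterra_lo 0 x t * f t + volterra_up w x t * f t))"
        proof (rule integral_cong_AE)
          have "AE t in I01. t \<noteq> x"
            using AE_lborel_singleton[of x] by (auto simp: AE_restrict_space_iff elim: eventually_mono)
          then show "AE t in I01. (LINT y|I01. volterra_lo 0 x y * volterra_up w y t) * f t =
              z * (volterra_lo 0 x t * f t + volterra_up w x t * f t)"
            using AE_space
          proof eventually_elim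
            case (elim t)
            then show ?case
              using x w re k0 by (simp add: volterra_compose_up space_I01 w_def algebra_simps)
          qed
        qed (use x in measurable)
        also have "\<dots> = z * (kernel_op (volterra_lo 0) f x + kernel_op (volterra_up w) f x)"
          unfolding kernel_op_def using elim(2,3) by simp
        also have "- \<dots> = z * (- kernel_op (volterra_up w) f x - cesaro_fun f x)"
          using x by (simp add: cesaro_fun_eq_kernel_op algebra_simps)
        finally show ?case unfolding neg .
      qed
    qed
  qed
qed

text \<open>The relation \<open>T k = z (k - T)\<close> gives \<open>(z - T) (1 / z + k / z\<^sup>2) = 1 + k / z - T / z - (k - T) / z = 1\<close>.\<close>

lemma cesaro_right_inverse:
  assumes p: "1 < p" and z: "z \<noteq> 0" and k: "Lp_kernel p N k"
    and comp: "AE x in I01. cesaro_fun (kernel_op k f) x = z * (kernel_op k f x - cesaro_fun f x)"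
    and f: "Lp_fun p f"
  defines "g \<equiv> \<lambda>x. 1 / z * f x + 1 / z\<^sup>2 * kernel_op k f x"
  shows "Lp_fun p g"
    and "Lp_power p g \<le> 2 powr p * (norm (1 / z) powr p + norm (1 / z\<^sup>2) powr p * N powr p) * Lp_power p f"
    and "AE x in I01. z * g x - cesaro_fun g x = f x"
proof -
  have kf: "Lp_fun p (kernel_op k f)" "Lp_power p (kernel_op k f) \<le> N powr p * Lp_power p f"
    using k f by (auto simp: Lp_kernel_def)
  note add = Lp_fun_add[OF Lp_fun_cmult(1)[OF f, of "1 / z"] Lp_fun_cmult(1)[OF kf(1), of "1 / z\<^sup>2"]]
  show "Lp_fun p g" unfolding g_def using p by (intro add) auto
  have "Lp_power p g \<le> 2 powr p * (norm (1 / z) powr p * Lp_power p f + norm (1 / z\<^sup>2) powr p * Lp_power p (kernel_op k f))"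
    unfolding g_def Lp_fun_cmult(2)[OF f, symmetric] Lp_fun_cmult(2)[OF kf(1), symmetric]
    using p by (intro add) auto
  also have "\<dots> \<le> 2 powr p * (norm (1 / z) powr p * Lp_power p f + norm (1 / z\<^sup>2) powr p * (N powr p * Lp_power p f))"
    by (intro mult_left_mono add_left_mono kf) auto
  finally show "Lp_power p g \<le> 2 powr p * (norm (1 / z) powr p + norm (1 / z\<^sup>2) powr p * N powr p) * Lp_power p f"
    by (simp add: algebra_simps)
  show "AE x in I01. z * g x - cesaro_fun g x = f x"
    using comp AE_space
  proof eventually_elim
    case (elim x)
    have "cesaro_fun g x = 1 / z * cesaro_fun f x + 1 / z\<^sup>2 * cesaro_fun (kernel_op k f) x"
      unfolding g_def using p elim(2) by (intro cesaro_fun_linear[OF f kf(1)]) (auto simp: space_I01)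
    then show ?case
      using z unfolding elim(1) g_def by (simp add: field_simps power2_eq_square)
  qed
qed

section \<open>The eigenvalue equation and its inhomogeneous version\<close>

lemma Lp_fun_reflect:
  assumes "Lp_fun p f"
  shows "Lp_fun p (\<lambda>x. f (1 - x))"
proof -
  note [measurable] = Lp_fun_measurable[OF assms]
  have "(\<lambda>x::real. 1 - x) \<in> measurable I01 I01"
    by (rule measurable_restrict_space2) (auto simp: space_I01)
  from measurable_compose[OF this Lp_fun_measurable[OF assms]]
  have [measurable]: "(\<lambda>x. f (1 - x)) \<in> borel_measurable I01" .
  have "(\<integral>\<^sup>+x. norm (f (1 - x)) powr p \<partial>I01) = (\<integral>\<^sup>+x. norm (f x) powr p \<partial>I01)"
    by (rule nn_integral_reflect_I01[where h = "\<lambda>x. ennreal (norm (f x) powr p)"]) measurable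
  then show ?thesis
    using Lp_power_nonneg by (intro Lp_fun_nn_integral_bound(1)) (auto simp: nn_integral_Lp_fun[OF assms])
qed

text \<open>The function \<open>1 / x\<close> is not integrable near \<open>0\<close>.\<close>

lemma Lp_fun_not_above_inverse_near_0:
  assumes f: "Lp_fun p f" and d: "0 < d" and e: "0 < e" "e \<le> 1"
    and lower: "\<And>x. 0 < x \<Longrightarrow> x < e \<Longrightarrow> d / x \<le> norm (f x) powr p"
  shows False
proof -
  \<comment> \<open>With this choice the integral of \<open>d / x\<close> over \<open>{h..e / 2}\<close> is \<open>Lp_power p f + 1\<close>.\<close>
  define h where "h = e / 2 * exp (- ((Lp_power p f + 1) / d))"
  have h: "0 < h" "h < e"
  proof -
    have "exp (- ((Lp_power p f + 1) / d)) \<le> 1"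
      using d Lp_power_nonneg[of p f] by simp
    then have "h \<le> e / 2" unfolding h_def using e by (simp add: mult_left_le)
    then show "h < e" using e by simp
  qed (use e in \<open>simp add: h_def\<close>)
  have "ennreal (d * ln (e / 2) - d * ln h) = (\<integral>\<^sup>+x. ennreal (d / x) * indicator {h..e / 2} x \<partial>lborel)"
  proof (rule nn_integral_FTC_Icc[symmetric])
    show "h \<le> e / 2" unfolding h_def using e d Lp_power_nonneg[of p f] by (simp add: mult_left_le)
    show "((\<lambda>x. d * ln x) has_real_derivative d / x) (at x)" if "x \<in> {h..e / 2}" for x
      using that h by (auto intro!: derivative_eq_intros)
  qed (use h d in \<open>auto intro!: divide_nonneg_pos\<close>)
  also have "\<dots> \<le> (\<integral>\<^sup>+x. ennreal (norm (f x) powr p) * indicator {0<..<1} x \<partial>lborel)"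
    using lower h e by (intro nn_integral_mono) (auto simp: indicator_def intro!: ennreal_leI)
  also have "\<dots> = ennreal (Lp_power p f)"
    using nn_integral_Lp_fun[OF f] by (simp add: nn_integral_restrict_space)
  finally have "d * (ln (e / 2) - ln h) \<le> Lp_power p f"
    using Lp_power_nonneg[of p f] by (simp add: right_diff_distrib)
  moreover have "ln h = ln (e / 2) - (Lp_power p f + 1) / d"
    unfolding h_def using e by (subst ln_mult) auto
  ultimately show False using d by simp
qed

text \<open>The sets with vanishing integral form a Dynkin system that contains the generators \<open>{..<x}\<close> of the Borel sets.\<close>

lemma integral_zero_on_lessThan_imp_AE_zero:
  fixes g :: "real \<Rightarrow> complex"
  assumes g: "integrable lborel g" and total: "integral\<^sup>L lborel g = 0"
    and zero: "\<And>x. (LINT t:{..<x}|lborel. g t) = 0"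
  shows "AE t in lborel. g t = 0"
proof (rule sigma_finite_measure.density_zero[OF lborel.sigma_finite_measure_axioms g])
  have gA: "set_integrable lborel A g" if "A \<in> sets borel" for A
    using g that unfolding set_integrable_def by (intro integrable_mult_indicator) auto
  fix A :: "real set" assume "A \<in> sets lborel"
  then have A: "A \<in> sigma_sets UNIV (range lessThan)"
    by (simp add: borel_Iio)
  have subset_Pow_UNIV: "range lessThan \<subseteq> Pow (UNIV :: real set)" by simp
  have "Int_stable (range (lessThan :: real \<Rightarrow> real set))"
    by (force simp: Int_stable_def intro: image_eqI[where x = "min a b" for a b])
  then show "(LINT t:A|lborel. g t) = 0"
    using subset_Pow_UNIV A
  proof (induct rule: sigma_sets_induct_disjoint)
    case (basic A) then show ?case using zero by auto
  next
    case (compl A)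
    then have [measurable]: "A \<in> sets borel" by (simp add: borel_Iio)
    have "(LINT t:A \<union> (UNIV - A)|lborel. g t) = (LINT t:A|lborel. g t) + (LINT t:UNIV - A|lborel. g t)"
      by (rule set_integral_Un) (auto intro: gA)
    then show ?case using compl total by (simp add: set_lebesgue_integral_def)
  next
    case (union A)
    then have [measurable]: "A i \<in> sets borel" for i by (simp add: borel_Iio image_subset_iff)
    have "(LINT t:(\<Union>i. A i)|lborel. g t) = (\<Sum>i. LINT t:A i|lborel. g t)"
      using union by (intro lebesgue_integral_countable_add gA) (auto simp: disjoint_family_on_def)
    then show ?case using union by simp
  qed (simp add: set_lebesgue_integral_def)
qed

text \<open>The function \<open>x powr (z - 1) * (1 - x) powr (- z)\<close>, which corresponds to the power \<open>u powr (z - 1)\<close> on the half-line.\<close>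

definition eigenfun :: "complex \<Rightarrow> real \<Rightarrow> complex" where
  "eigenfun z x = exp (z * of_real (logit x)) / of_real x"

lemma eigenfun_measurable: "eigenfun z \<in> borel_measurable I01"
  unfolding eigenfun_def[abs_def] by measurable

lemma norm_eigenfun: "0 < x \<Longrightarrow> norm (eigenfun z x) = exp (Re z * logit x) / x"
  by (simp add: eigenfun_def norm_divide)

lemma norm_eigenfun_powr:
  assumes "x \<in> {0<..<1}"
  shows "norm (eigenfun z x) powr p = x powr (p * Re z - p) * (1 - x) powr (- (p * Re z))"
  using assms
  by (simp add: norm_eigenfun powr_def logit_def ln_div flip: exp_add) (simp add: algebra_simps)

lemma Lp_fun_eigenfun:
  assumes "1 \<le> p" "1 - 1 / p < Re z" "Re z < 1 / p"
  shows "Lp_fun p (eigenfun z)"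
proof -
  have "set_integrable lborel {0..1} (\<lambda>t. t powr ((p * Re z - p + 1) - 1) * (1 - t) powr ((1 - p * Re z) - 1))"
    using assms by (intro integrable_Beta) (auto simp: field_simps)
  then have "set_integrable lborel {0..1} (\<lambda>t. t powr (p * Re z - p) * (1 - t) powr (- (p * Re z)))"
    by simp
  then have "set_integrable lborel {0<..<1} (\<lambda>t. t powr (p * Re z - p) * (1 - t) powr (- (p * Re z)))"
    by (rule set_integrable_subset) auto
  then have "integrable I01 (\<lambda>t. t powr (p * Re z - p) * (1 - t) powr (- (p * Re z)))"
    by (simp add: integrable_restrict_space set_integrable_def)
  then have "integrable I01 (\<lambda>x. norm (eigenfun z x) powr p)"
    by (rule Bochner_Integration.integrable_cong[THEN iffD1, rotated 2]) (auto simp: norm_eigenfun_powr space_I01)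
  then show ?thesis by (simp add: Lp_fun_def eigenfun_measurable)
qed

lemma cesaro_fun_eigenfun:
  assumes "0 < Re z" "x \<in> {0<..<1}"
  shows "cesaro_fun (eigenfun z) x = eigenfun z x / z"
proof -
  have "(LINT t:{0<..<x}|lborel. eigenfun z t / (1 - of_real t)) = exp (z * of_real (logit x)) / z"
    using exp_logit_integral_0(2)[of z x] assms by (simp add: eigenfun_def)
  then show ?thesis by (simp add: cesaro_fun_def eigenfun_def)
qed

definition primitive :: "(real \<Rightarrow> complex) \<Rightarrow> real \<Rightarrow> complex" where
  "primitive f x = (LINT t:{0<..<x}|lborel. f t / (1 - of_real t))"

lemma cesaro_fun_primitive: "cesaro_fun f x = primitive f x / of_real x"
  by (simp add: cesaro_fun_def primitive_def)

lemma primitive_integrable: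
  assumes "Lp_fun p f" "1 \<le> p" "b < 1"
  shows "set_integrable lborel {0<..<b} (\<lambda>t. f t / (1 - of_real t))"
  using assms cesaro_integrable[of f p b] by (cases "0 < b") (auto simp: Lp_fun_def)

lemma primitive_diff:
  assumes "Lp_fun p f" "1 \<le> p" "0 < a" "a \<le> b" "b < 1"
  shows "primitive f b = primitive f a + (LBINT t=a..b. f t / (1 - of_real t))"
proof -
  have "primitive f b = (LBINT t=0..b. f t / (1 - of_real t))" "primitive f a = (LBINT t=0..a. f t / (1 - of_real t))"
    using assms by (simp_all add: primitive_def interval_lebesgue_integral_def einterval_eq zero_ereal_def)
  moreover have "(LBINT t=0..a. f t / (1 - of_real t)) + (LBINT t=a..b. f t / (1 - of_real t))
      = (LBINT t=0..b. f t / (1 - of_real t))"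
    using primitive_integrable[OF assms(1,2,5)] assms
    by (intro interval_integral_sum) (simp add: interval_lebesgue_integrable_def min_def max_def einterval_eq zero_ereal_def)
  ultimately show ?thesis by simp
qed

lemma continuous_on_primitive:
  assumes "Lp_fun p f" "1 \<le> p"
  shows "continuous_on {0<..<1} (primitive f)"
proof -
  have "continuous_on {0<..<b} (primitive f)" if b: "b < 1" for b
  proof -
    have "(\<lambda>t. f t / (1 - of_real t)) integrable_on {0<..<b}"
      using primitive_integrable[OF assms b] by (rule set_borel_integral_eq_integral)
    then have int: "(\<lambda>t. f t / (1 - of_real t)) integrable_on {0..b}"
      by (simp add: integrable_on_open_interval_real)
    have "primitive f x = integral {0..x} (\<lambda>t. f t / (1 - of_real t))" if "x \<in> {0<..<b}" for x
      using that b primitive_integrable[OF assms, of x] unfolding primitive_def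
      by (subst set_borel_integral_eq_integral(2)) (auto simp: integral_open_interval_real)
    moreover have "continuous_on {0<..<b} (\<lambda>x. integral {0..x} (\<lambda>t. f t / (1 - of_real t)))"
      using indefinite_integral_continuous_1[OF int] by (rule continuous_on_subset) auto
    ultimately show ?thesis by (simp cong: continuous_on_cong_simp)
  qed
  then have "continuous_on (\<Union>b\<in>{..<1}. {0<..<b}) (primitive f)"
    by (intro continuous_on_open_UN) auto
  moreover have "(\<Union>b\<in>{..<1::real}. {0<..<b}) = {0<..<1}"
    using dense by fastforce
  ultimately show ?thesis by simp
qed

lemma open_set_Lebesgue_null:
  fixes S :: "real set"
  assumes "open S" "AE x in lborel. x \<notin> S"
  shows "S = {}"
proof (rule ccontr)
  assume "S \<noteq> {}"
  then obtain a e where "0 < e" "ball a e \<subseteq> S"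
    using assms(1) open_contains_ball by blast
  then have "AE x in lborel. x \<notin> {a..a + e / 2}"
    using assms(2) by (auto elim!: eventually_mono simp: subset_eq dist_real_def)
  then have "emeasure lborel {a..a + e / 2} = 0"
    using AE_iff_measurable[of "{a..a + e / 2}" lborel "\<lambda>x. x \<notin> {a..a + e / 2}"]
    by (simp add: atLeastAtMost_def atLeast_def atMost_def Collect_conj_eq)
  then show False using \<open>0 < e\<close> by simp
qed

text \<open>The set where two continuous functions differ is open, and a nonempty open set is not a null set.\<close>

lemma AE_I01_eq_continuous:
  fixes f g :: "real \<Rightarrow> complex"
  assumes "AE x in I01. x \<in> U \<longrightarrow> f x = g x" "open U" "U \<subseteq> {0<..<1}"
    "continuous_on U f" "continuous_on U g" "x \<in> U"
  shows "f x = g x"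
proof -
  have "open (U \<inter> (\<lambda>x. f x - g x) -` (- {0}))"
    using assms by (intro continuous_open_preimage continuous_intros) auto
  moreover have "AE x in lborel. x \<notin> U \<inter> (\<lambda>x. f x - g x) -` (- {0})"
    using assms(1,3) by (auto simp: AE_restrict_space_iff elim!: eventually_mono)
  ultimately have "U \<inter> (\<lambda>x. f x - g x) -` (- {0}) = {}"
    by (rule open_set_Lebesgue_null)
  then show ?thesis using assms(6) by auto
qed

text \<open>The case of the eigenvalue \<open>0\<close> is not covered by the differential equation. The primitive vanishes everywhere by
  continuity, hence so do all integrals of \<open>f t / (1 - t)\<close> over intervals.\<close>

lemma cesaro_fun_eq_zero_imp:
  assumes f: "Lp_fun p f" and p: "1 \<le> p" and zero: "AE x in I01. cesaro_fun f x = 0"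
  shows "AE x in I01. f x = 0"
proof -
  note [measurable] = Lp_fun_measurable[OF f]
  have primitive_0: "primitive f x = 0" if "x \<in> {0<..<1}" for x
  proof (rule AE_I01_eq_continuous[where U = "{0<..<1}" and g = "\<lambda>_. 0"])
    show "AE x in I01. x \<in> {0<..<1} \<longrightarrow> primitive f x = 0"
      using zero by eventually_elim (auto simp: cesaro_fun_primitive)
  qed (use that continuous_on_primitive[OF f p] in auto)
  have on_b: "AE t in lborel. indicator {0<..<b} t *\<^sub>R (f t / (1 - of_real t)) = 0" if b: "0 < b" "b < 1" for b
  proof (rule integral_zero_on_lessThan_imp_AE_zero)
    show "integrable lborel (\<lambda>t. indicator {0<..<b} t *\<^sub>R (f t / (1 - of_real t)))"
      using primitive_integrable[OF f p b(2)] by (simp add: set_integrable_def)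
    show "(LINT t|lborel. indicator {0<..<b} t *\<^sub>R (f t / (1 - of_real t))) = 0"
      using primitive_0[of b] b by (simp add: primitive_def set_lebesgue_integral_def)
    fix x :: real
    have "(LINT t:{..<x}|lborel. indicator {0<..<b} t *\<^sub>R (f t / (1 - of_real t)))
        = (LINT t:{0<..<min x b}|lborel. f t / (1 - of_real t))"
      unfolding set_lebesgue_integral_def
      by (intro Bochner_Integration.integral_cong) (auto simp: indicator_def)
    also have "\<dots> = 0"
      using primitive_0[of "min x b"] b unfolding primitive_def by (cases "0 < x") (auto simp: set_lebesgue_integral_def)
    finally show "(LINT t:{..<x}|lborel. indicator {0<..<b} t *\<^sub>R (f t / (1 - of_real t))) = 0" .
  qed
  have "AE t in lborel. \<forall>n::nat. indicator {0<..<1 - 1 / real (n + 2)} t *\<^sub>R (f t / (1 - of_real t)) = 0"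
    unfolding AE_all_countable
  proof
    show "AE t in lborel. indicator {0<..<1 - 1 / real (n + 2)} t *\<^sub>R (f t / (1 - of_real t)) = 0" for n
      by (rule on_b) (auto simp: field_simps)
  qed
  then have "AE t in lborel. t \<in> {0<..<1} \<longrightarrow> f t = 0"
  proof eventually_elim
    case (elim t)
    show ?case
    proof
      assume t: "t \<in> {0<..<1}"
      then obtain n :: nat where "1 / (1 - t) < real n"
        using reals_Archimedean2 by blast
      then have "t < 1 - 1 / real (n + 2)"
        using t by (simp add: field_simps)
      with elim t show "f t = 0" by (auto simp: indicator_def dest!: spec[of _ n])
    qed
  qed
  then show ?thesis by (simp add: AE_restrict_space_iff)
qed

text \<open>The equation lets \<open>f\<close> be replaced under the integral by a continuous function, so that the primitive is
  differentiable and solves a linear first-order equation with homogeneous solution \<open>exp (z * logit x)\<close>. The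
  inhomogeneous term is chosen such that the variation of constants produces the polynomial \<open>k * x + c\<close>. The case
  \<open>k = 0\<close> is the eigenvalue equation, and \<open>k = 1\<close> serves to refute surjectivity.\<close>

lemma cesaro_ode:
  assumes f: "Lp_fun p f" and p: "1 \<le> p" and z: "z \<noteq> 0"
    and eq: "AE x in I01. f x = z * cesaro_fun f x + k * exp (z * of_real (logit x)) * (1 - of_real x)"
  obtains c where "AE x in I01. f x = eigenfun z x * (z * (k * of_real x + c) + k * of_real (x * (1 - x)))"
proof -
  note [measurable] = Lp_fun_measurable[OF f]
  define E where "E x = exp (z * of_real (logit x))" for x
  define v where "v x = k * E x + z * primitive f x / of_real (x * (1 - x))" for x
  have E0: "E x \<noteq> 0" for x by (simp add: E_def)
  have cont_E: "continuous_on {0<..<1} E"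
    unfolding E_def by (intro continuous_intros continuous_on_logit) auto
  have cont_v: "continuous_on {0<..<1} v"
    unfolding v_def by (intro continuous_intros cont_E continuous_on_primitive[OF f p]) auto
  have ae: "AE t in lborel. t \<in> {0<..<1} \<longrightarrow> f t / (1 - of_real t) = v t"
  proof -
    have "AE t in lborel. t \<in> {0<..<1} \<longrightarrow> f t = z * cesaro_fun f t + k * E t * (1 - of_real t)"
      using eq by (simp add: AE_restrict_space_iff E_def)
    then show ?thesis
    proof eventually_elim
      case (elim t)
      have "1 - complex_of_real t \<noteq> 0" if "t < 1"
        using that by (metis of_real_1 of_real_diff of_real_eq_0_iff less_irrefl right_minus_eq)
      then show ?case using elim by (auto simp: v_def cesaro_fun_primitive add_divide_distrib)
    qed
  qed
  have primitive_deriv: "(primitive f has_vector_derivative v x) (at x)" if x: "x \<in> {0<..<1}" for x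
  proof -
    define a b where "a = x / 2" and "b = (x + 1) / 2"
    have ab: "0 < a" "a < x" "x < b" "b < 1" using x by (auto simp: a_def b_def)
    have "((\<lambda>u. LBINT t=a..u. v t) has_vector_derivative v x) (at x within {a..b})"
      using ab by (intro interval_integral_FTC2 continuous_on_subset[OF cont_v]) auto
    then have deriv: "((\<lambda>u. primitive f a + (LBINT t=a..u. v t)) has_vector_derivative v x) (at x within {a..b})"
      using has_vector_derivative_add[OF has_vector_derivative_const] by fastforce
    have eq: "primitive f u = primitive f a + (LBINT t=a..u. v t)" if u: "u \<in> {a..b}" for u
    proof -
      have "set_integrable lborel {a<..<u} (\<lambda>t. f t / (1 - of_real t))"
        using primitive_integrable[OF f p, of u] by (rule set_integrable_subset) (use u ab in auto)
      moreover have "set_integrable lborel {a<..<u} v"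
        by (rule set_integrable_subset[OF borel_integrable_atLeastAtMost'[of a u]])
          (use u ab in \<open>auto intro: continuous_on_subset[OF cont_v]\<close>)
      ultimately have "(LINT t:{a<..<u}|lborel. f t / (1 - of_real t)) = (LINT t:{a<..<u}|lborel. v t)"
        unfolding set_lebesgue_integral_def set_integrable_def
        using ae u ab by (intro integral_cong_AE) (auto simp: indicator_def elim!: eventually_mono)
      then have "(LBINT t=a..u. f t / (1 - of_real t)) = (LBINT t=a..u. v t)"
        using u by (simp add: interval_lebesgue_integral_def einterval_eq)
      then show ?thesis using primitive_diff[OF f p, of a u] u ab by simp
    qed
    have "(primitive f has_vector_derivative v x) (at x within {a..b})"
      by (rule has_vector_derivative_transform[OF _ eq deriv]) (use ab in auto)
    then show ?thesis
      using ab by (simp add: at_within_Icc_at)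
  qed
  \<comment> \<open>Variation of constants: the product in \<open>W\<close> has the constant derivative \<open>k\<close>.\<close>
  define W where "W x = primitive f x * exp ((- z) * of_real (logit x)) - k * of_real x" for x
  have "\<exists>c. \<forall>x\<in>{0<..<1}. W x = c"
  proof (rule has_vector_derivative_zero_constant)
    fix x :: real assume x: "x \<in> {0<..<1}"
    have "((\<lambda>x. k * of_real x) has_vector_derivative k) (at x)"
      by (auto intro!: derivative_eq_intros)
    moreover have "((\<lambda>x. primitive f x * exp ((- z) * of_real (logit x))) has_vector_derivative
        primitive f x * ((- z) * exp ((- z) * of_real (logit x)) / of_real (x * (1 - x)))
        + v x * exp ((- z) * of_real (logit x))) (at x)"
      using x by (intro has_vector_derivative_mult has_vector_derivative_exp_logit primitive_deriv) auto
    moreover have "primitive f x * ((- z) * exp ((- z) * of_real (logit x)) / of_real (x * (1 - x)))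
        + v x * exp ((- z) * of_real (logit x)) = k"
    proof -
      have "E x * exp ((- z) * of_real (logit x)) = 1"
        by (simp add: E_def flip: exp_add)
      then show ?thesis by (simp add: v_def algebra_simps)
    qed
    ultimately have "(W has_vector_derivative k - k) (at x)"
      unfolding W_def[abs_def] by (intro has_vector_derivative_diff) auto
    then show "(W has_vector_derivative 0) (at x within {0<..<1})"
      by (simp add: has_vector_derivative_at_within)
  qed auto
  then obtain c where c: "W x = c" if "x \<in> {0<..<1}" for x by blast
  have primitive_eq: "primitive f x = (k * of_real x + c) * E x" if "x \<in> {0<..<1}" for x
  proof -
    have "exp ((- z) * of_real (logit x)) * E x = 1"
      by (simp add: E_def flip: exp_add)
    moreover have "primitive f x * exp ((- z) * of_real (logit x)) = k * of_real x + c"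
      using c[OF that] by (simp add: W_def algebra_simps)
    ultimately show ?thesis by (metis mult.assoc mult.right_neutral)
  qed
  have "AE x in I01. f x = eigenfun z x * (z * (k * of_real x + c) + k * of_real (x * (1 - x)))"
    using eq AE_space
  proof eventually_elim
    case (elim x)
    then have "x \<in> {0<..<1}" by (simp add: space_I01)
    then show ?case
      unfolding elim(1) cesaro_fun_primitive primitive_eq[OF \<open>x \<in> {0<..<1}\<close>] eigenfun_def E_def[symmetric]
      by (simp add: field_simps)
  qed
  then show ?thesis by (rule that)
qed

lemma Lp_fun_power_near_0:
  assumes f: "Lp_fun p f"
    and eq: "\<And>x. x \<in> {0<..<1} \<Longrightarrow> norm (f x) powr p = x powr s * r x"
    and lim: "(r \<longlongrightarrow> L) (at_right 0)" and L: "0 < L"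
  shows "- 1 < s"
proof (rule ccontr)
  assume s: "\<not> - 1 < s"
  have "eventually (\<lambda>x. L / 2 < r x) (at_right 0)"
    using order_tendstoD(1)[OF lim, of "L / 2"] L by simp
  then obtain b where b: "0 < b" "\<And>x. 0 < x \<Longrightarrow> x < b \<Longrightarrow> L / 2 < r x"
    unfolding eventually_at_right_field by auto
  show False
  proof (rule Lp_fun_not_above_inverse_near_0[OF f, of "L / 2" "min b 1"])
    fix x assume x: "0 < x" "x < min b 1"
    have "L / 2 / x = x powr (- 1) * (L / 2)"
      using x by (simp add: powr_minus_divide)
    also have "\<dots> \<le> x powr s * r x"
      using x s b(2)[of x] L by (intro mult_mono powr_mono') auto
    finally show "L / 2 / x \<le> norm (f x) powr p"
      using x eq[of x] by simp
  qed (use L b in auto)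
qed

text \<open>The modulus of the product behaves like \<open>norm (q 0) * x powr (Re z - 1)\<close> at the left end point.\<close>

lemma Lp_fun_eigenfun_mult_at_0:
  assumes f: "Lp_fun p (\<lambda>x. eigenfun z x * q x)" and q: "continuous_on {0..1} q" "q 0 \<noteq> 0" and p: "0 < p"
  shows "1 - 1 / p < Re z"
proof -
  have "- 1 < p * Re z - p"
  proof (rule Lp_fun_power_near_0[OF f])
    show "norm (eigenfun z x * q x) powr p = x powr (p * Re z - p) * ((1 - x) powr (- (p * Re z)) * norm (q x) powr p)"
      if "x \<in> {0<..<1}" for x
      using norm_eigenfun_powr[OF that] by (simp add: norm_mult powr_mult)
    have "(q \<longlongrightarrow> q 0) (at 0 within {0..1})"
      using q(1) by (auto simp: continuous_on_def)
    then have "(q \<longlongrightarrow> q 0) (at_right 0)"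
      by (simp add: at_within_Icc_at_right)
    then show "((\<lambda>x. (1 - x) powr (- (p * Re z)) * norm (q x) powr p) \<longlongrightarrow> (1 - 0) powr (- (p * Re z)) * norm (q 0) powr p) (at_right 0)"
      using q(2) by (intro tendsto_intros) auto
  qed (use q(2) in simp)
  then show ?thesis using p by (simp add: field_simps)
qed

text \<open>The modulus of the product behaves like \<open>norm (q 1) * (1 - x) powr (- Re z)\<close> at the right end point.\<close>

lemma Lp_fun_eigenfun_mult_at_1:
  assumes f: "Lp_fun p (\<lambda>x. eigenfun z x * q x)" and q: "continuous_on {0..1} q" "q 1 \<noteq> 0" and p: "0 < p"
  shows "Re z < 1 / p"
proof -
  have "- 1 < - (p * Re z)"
  proof (rule Lp_fun_power_near_0[OF Lp_fun_reflect[OF f]])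
    show "norm (eigenfun z (1 - x) * q (1 - x)) powr p = x powr (- (p * Re z)) * ((1 - x) powr (p * Re z - p) * norm (q (1 - x)) powr p)"
      if "x \<in> {0<..<1}" for x
      using norm_eigenfun_powr[of "1 - x"] that by (simp add: norm_mult powr_mult)
    have "continuous_on {0..1} (\<lambda>x. q (1 - x))"
      by (rule continuous_on_compose2[OF q(1)]) (auto intro!: continuous_intros)
    then have "((\<lambda>x. q (1 - x)) \<longlongrightarrow> q (1 - 0)) (at 0 within {0..1})"
      unfolding continuous_on_def by (rule bspec) simp
    then have "((\<lambda>x. q (1 - x)) \<longlongrightarrow> q 1) (at_right 0)"
      by (simp add: at_within_Icc_at_right)
    then show "((\<lambda>x. (1 - x) powr (p * Re z - p) * norm (q (1 - x)) powr p) \<longlongrightarrow> (1 - 0) powr (p * Re z - p) * norm (q 1) powr p) (at_right 0)"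
      using q(2) by (intro tendsto_intros) auto
  qed (use q(2) in simp)
  then show ?thesis using p by (simp add: field_simps)
qed

lemma Lp_fun_cong_AE:
  assumes "Lp_fun p f" "AE x in I01. f x = g x" "g \<in> borel_measurable I01"
  shows "Lp_fun p g"
proof -
  note [measurable] = Lp_fun_measurable[OF assms(1)] assms(3)
  have "integrable I01 (\<lambda>x. norm (f x) powr p) \<longleftrightarrow> integrable I01 (\<lambda>x. norm (g x) powr p)"
    using assms(2) by (intro integrable_cong_AE) auto
  then show ?thesis using assms by (simp add: Lp_fun_def)
qed

text \<open>In the polynomial factor the values at the two end points are \<open>z * c\<close> and \<open>z * (k + c)\<close>. For \<open>k = 0\<close> they vanish
  together, whereas for \<open>k = 1\<close> at least one of them differs from \<open>0\<close>.\<close>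

lemma cesaro_ode_Lp_fun:
  assumes f: "Lp_fun p f" and p: "1 \<le> p" and z: "z \<noteq> 0"
    and eq: "AE x in I01. f x = z * cesaro_fun f x + k * exp (z * of_real (logit x)) * (1 - of_real x)"
  obtains c where "AE x in I01. f x = eigenfun z x * (z * (k * of_real x + c) + k * of_real (x * (1 - x)))"
    "c \<noteq> 0 \<Longrightarrow> 1 - 1 / p < Re z" "k + c \<noteq> 0 \<Longrightarrow> Re z < 1 / p"
proof -
  obtain c where c: "AE x in I01. f x = eigenfun z x * (z * (k * of_real x + c) + k * of_real (x * (1 - x)))"
    using cesaro_ode[OF assms] .
  define q where "q x = z * (k * of_real x + c) + k * of_real (x * (1 - x))" for x
  have q: "continuous_on {0..1} q" unfolding q_def by (intro continuous_intros)
  have [measurable]: "eigenfun z \<in> borel_measurable I01" by (rule eigenfun_measurable)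
  have "Lp_fun p (\<lambda>x. eigenfun z x * q x)"
    by (rule Lp_fun_cong_AE[OF f c[folded q_def]]) (simp add: q_def[abs_def])
  note at_0 = Lp_fun_eigenfun_mult_at_0[OF this q] and at_1 = Lp_fun_eigenfun_mult_at_1[OF this q]
  show ?thesis
    using at_0 at_1 p z by (intro that[OF c]) (auto simp: q_def simp flip: distrib_left)
qed

lemma cesaro_fun_eigenvalue:
  assumes f: "Lp_fun p f" and p: "1 \<le> p" and eq: "AE x in I01. cesaro_fun f x = w * f x"
    and nz: "\<not> (AE x in I01. f x = 0)"
  shows "w \<noteq> 0" "1 - 1 / p < Re (1 / w)" "Re (1 / w) < 1 / p"
proof -
  show w: "w \<noteq> 0"
    using cesaro_fun_eq_zero_imp[OF f p] eq nz by auto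
  have "AE x in I01. f x = 1 / w * cesaro_fun f x + 0 * exp (1 / w * of_real (logit x)) * (1 - of_real x)"
    using eq by eventually_elim (simp add: w)
  from cesaro_ode_Lp_fun[OF f p _ this] w obtain c where
    c: "AE x in I01. f x = eigenfun (1 / w) x * (1 / w * (0 * of_real x + c) + 0 * of_real (x * (1 - x)))"
      "c \<noteq> 0 \<Longrightarrow> 1 - 1 / p < Re (1 / w)" "c \<noteq> 0 \<Longrightarrow> Re (1 / w) < 1 / p"
    by auto
  have "c \<noteq> 0" using c(1) nz by auto
  with c(2,3) show "1 - 1 / p < Re (1 / w)" "Re (1 / w) < 1 / p" by auto
qed

section \<open>Functions outside the range, and almost extremal functions\<close>

text \<open>This is \<open>x powr z * (1 - x) powr (1 - z)\<close>, the inhomogeneous term of the equation in \<open>cesaro_ode\<close>.\<close>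

definition beta_fun :: "complex \<Rightarrow> real \<Rightarrow> complex" where
  "beta_fun z x = exp (z * of_real (logit x)) * (1 - of_real x)"

lemma Lp_fun_beta_fun:
  assumes "0 < Re z" "Re z < 1" "0 \<le> p"
  shows "Lp_fun p (beta_fun z)"
proof (rule Lp_fun_bounded)
  show "beta_fun z \<in> borel_measurable I01"
    unfolding beta_fun_def[abs_def] by measurable
  fix x :: real assume x: "x \<in> {0<..<1}"
  have "norm (beta_fun z x) = exp (Re z * logit x) * norm (of_real (1 - x) :: complex)"
    by (simp add: beta_fun_def norm_mult)
  also have "\<dots> = exp (Re z * logit x) * (1 - x)"
    using x unfolding norm_of_real by simp
  also have "\<dots> = x powr Re z * (1 - x) powr (1 - Re z)"
  proof -
    have "exp (Re z * logit x) * (1 - x) = exp (Re z * logit x) * exp (ln (1 - x))"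
      using x by simp
    then show ?thesis
      using x by (simp add: powr_def logit_def algebra_simps flip: exp_add)
  qed
  also have "\<dots> \<le> 1 * 1"
    using x assms by (intro mult_mono) (auto intro!: powr_le1)
  finally show "norm (beta_fun z x) \<le> 1" by simp
qed fact

text \<open>By the choice of the right-hand side every solution is, up to a factor that is continuous on the closed interval, the
  eigenfunction. The strip condition forbids its singularity at either end point, but the factor cannot vanish at both.\<close>

lemma cesaro_not_surjective:
  assumes f: "Lp_fun p f" and p: "1 \<le> p" and w: "w \<noteq> 0"
    and re: "1 / p \<le> Re (1 / w)" "Re (1 / w) \<le> 1 - 1 / p"
    and eq: "AE x in I01. w * f x - cesaro_fun f x = w * beta_fun (1 / w) x"
  shows False
proof -
  have "AE x in I01. f x = 1 / w * cesaro_fun f x + 1 * exp (1 / w * of_real (logit x)) * (1 - of_real x)"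
    using eq by eventually_elim (simp add: w beta_fun_def field_simps)
  from cesaro_ode_Lp_fun[OF f p _ this] w re show False
    by (metis add.right_neutral divide_eq_0_iff not_less one_neq_zero)
qed

text \<open>Functions in the range of the Cesaro operator are continuous up to null sets, and a jump is not.\<close>

lemma cesaro_0_not_surjective:
  assumes f: "Lp_fun p f" and p: "1 \<le> p"
    and eq: "AE x in I01. cesaro_fun f x = (if 1 / 2 < x then 1 else 0)"
  shows False
proof -
  have cont: "continuous_on {0<..<1} (primitive f)" by (rule continuous_on_primitive[OF f p])
  have left: "primitive f x = 0" if "x \<in> {0<..<1 / 2}" for x
  proof (rule AE_I01_eq_continuous[where U = "{0<..<1 / 2}" and g = "\<lambda>_. 0"])
    show "AE x in I01. x \<in> {0<..<1 / 2} \<longrightarrow> primitive f x = 0"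
      using eq by eventually_elim (auto simp: cesaro_fun_primitive)
  qed (use that in \<open>auto intro: continuous_on_subset[OF cont]\<close>)
  have right: "primitive f x = of_real x" if "x \<in> {1 / 2<..<1}" for x
  proof (rule AE_I01_eq_continuous[where U = "{1 / 2<..<1}"])
    show "AE x in I01. x \<in> {1 / 2<..<1} \<longrightarrow> primitive f x = of_real x"
      using eq by eventually_elim (auto simp: cesaro_fun_primitive)
  qed (use that in \<open>auto intro: continuous_on_subset[OF cont] continuous_intros\<close>)
  have "isCont (primitive f) (1 / 2)"
    using cont by (simp add: continuous_on_eq_continuous_at)
  then have lim: "(primitive f \<longlongrightarrow> primitive f (1 / 2)) (at (1 / 2))" by (simp add: isCont_def)
  have "((\<lambda>_::real. 0) \<longlongrightarrow> primitive f (1 / 2)) (at_left (1 / 2))"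
    by (rule Lim_transform_eventually[OF tendsto_within_subset[OF lim]])
      (auto simp: eventually_at_left_field left intro!: exI[of _ 0])
  then have "primitive f (1 / 2) = 0" by (simp add: tendsto_const_iff)
  have "(complex_of_real \<longlongrightarrow> primitive f (1 / 2)) (at_right (1 / 2))"
    by (rule Lim_transform_eventually[OF tendsto_within_subset[OF lim]])
      (auto simp: eventually_at_right_field right intro!: exI[of _ 1])
  moreover have "(complex_of_real \<longlongrightarrow> of_real (1 / 2)) (at_right (1 / 2))"
    by (intro tendsto_intros)
  ultimately have "primitive f (1 / 2) = of_real (1 / 2)"
    by (rule tendsto_unique[rotated]) simp
  with \<open>primitive f (1 / 2) = 0\<close> show False by simp
qed

definition pole_at_1 :: "real \<Rightarrow> real \<Rightarrow> complex" where
  "pole_at_1 a x = of_real ((1 - x) powr (- a))"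

lemma pole_at_1_Lp:
  assumes "0 < p" "0 < a" "a < 1 / p"
  shows "Lp_fun p (pole_at_1 a)" "Lp_power p (pole_at_1 a) = 1 / (1 - a * p)"
proof -
  have ap: "a * p < 1" using assms by (simp add: field_simps)
  define h where "h t = t powr (1 - 1) * (1 - t) powr ((1 - a * p) - 1)" for t :: real
  have h: "set_integrable lborel {0..1} h" "(h has_integral Beta 1 (1 - a * p)) {0..1}"
    unfolding h_def using ap integrable_Beta[of 1 "1 - a * p"] has_integral_Beta_real[of 1 "1 - a * p"] by simp_all
  have h': "set_integrable lborel {0<..<1} h"
    using h(1) by (rule set_integrable_subset) auto
  have eq: "norm (pole_at_1 a x) powr p = h x" if "x \<in> {0<..<1}" for x
    using that by (simp add: pole_at_1_def h_def powr_powr)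
  have "integrable I01 h" using h' by (simp add: integrable_restrict_space set_integrable_def)
  then have "integrable I01 (\<lambda>x. norm (pole_at_1 a x) powr p)"
    by (rule Bochner_Integration.integrable_cong[THEN iffD1, rotated 2]) (auto simp: eq space_I01)
  moreover have "pole_at_1 a \<in> borel_measurable I01"
    unfolding pole_at_1_def[abs_def] by measurable
  ultimately show "Lp_fun p (pole_at_1 a)" by (simp add: Lp_fun_def)
  have "Lp_power p (pole_at_1 a) = (\<integral>x. h x \<partial>I01)"
    unfolding Lp_power_def by (intro Bochner_Integration.integral_cong) (auto simp: eq space_I01)
  also have "\<dots> = (LINT x:{0<..<1}|lborel. h x)"
    by (simp add: integral_restrict_space set_lebesgue_integral_def)
  also have "\<dots> = integral {0..1} h"
    using h' by (simp add: set_borel_integral_eq_integral(2) integral_open_interval_real)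
  also have "\<dots> = Beta 1 (1 - a * p)" using h(2) by (rule integral_unique)
  also have "\<dots> = 1 / (1 - a * p)"
  proof -
    have "1 - a * p \<notin> \<int>\<^sub>\<le>\<^sub>0" using ap by (auto elim!: nonpos_Ints_cases)
    then have "Gamma (2 - a * p) = (1 - a * p) * Gamma (1 - a * p)"
      using Gamma_plus1[of "1 - a * p"] by simp
    moreover have "Gamma (1 - a * p) \<noteq> 0"
      using ap Gamma_real_pos[of "1 - a * p"] by (intro less_imp_neq[symmetric]) simp
    ultimately show ?thesis using ap by (simp add: Beta_def)
  qed
  finally show "Lp_power p (pole_at_1 a) = 1 / (1 - a * p)" .
qed

text \<open>Near \<open>1\<close>, where \<open>x\<close> is close to \<open>1\<close> and the constant \<open>1\<close> is small compared with the pole, the Cesaro operator almost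
  multiplies this function by \<open>1 / a\<close>.\<close>

lemma cesaro_fun_pole_at_1:
  assumes a: "0 < a" and x: "x \<in> {0<..<1}"
  shows "of_real a * of_real x * cesaro_fun (pole_at_1 a) x = pole_at_1 a x - 1"
proof -
  have "(LINT t:{0<..<x}|lborel. pole_at_1 a t / (1 - of_real t)) =
      (LINT t:{0<..<x}|lborel. complex_of_real ((1 - t) powr (- a) / (1 - t)))"
    by (simp add: pole_at_1_def)
  also have "\<dots> = of_real (LINT t:{0<..<x}|lborel. (1 - t) powr (- a) / (1 - t))"
    by (rule set_integral_complex_of_real)
  also have "(LINT t:{0<..<x}|lborel. (1 - t) powr (- a) / (1 - t)) = (LBINT t=0..x. (1 - t) powr (- a) / (1 - t))"
    using x by (simp add: interval_lebesgue_integral_def einterval_eq zero_ereal_def)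
  also have "\<dots> = (1 - x) powr (- a) / a - (1 - 0) powr (- a) / a"
    unfolding zero_ereal_def
  proof (rule interval_integral_FTC_finite)
    show "continuous_on {min 0 x..max 0 x} (\<lambda>t. (1 - t) powr (- a) / (1 - t))"
      using x by (intro continuous_intros) auto
    show "((\<lambda>t. (1 - t) powr (- a) / a) has_vector_derivative (1 - t) powr (- a) / (1 - t)) (at t within {min 0 x..max 0 x})"
      if "min 0 x \<le> t" "t \<le> max 0 x" for t
    proof -
      have "((\<lambda>t. (1 - t) powr (- a) / a) has_real_derivative (1 - t) powr (- a) / (1 - t)) (at t)"
        using that x a by (auto intro!: derivative_eq_intros simp: powr_diff)
      then show ?thesis
        by (simp add: has_real_derivative_iff_has_vector_derivative has_vector_derivative_at_within)
    qed
  qed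
  finally show ?thesis
    using x a by (simp add: cesaro_fun_def pole_at_1_def field_simps)
qed

text \<open>The functions \<open>pole_at_1 a\<close> are almost extremal as \<open>a\<close> increases to \<open>1 / p\<close>: by \<open>cesaro_fun_pole_at_1\<close> they are bounded
  by \<open>a * norm (cesaro_fun (pole_at_1 a) x) + 1\<close>, while their norms tend to infinity, so that the summand \<open>1\<close> is
  negligible.\<close>

lemma cesaro_bound_ge_p:
  assumes p: "1 \<le> p" and K: "0 \<le> K"
    and bound: "\<And>f. Lp_fun p f \<Longrightarrow> Lp_fun p (cesaro_fun f) \<and> Lp_power p (cesaro_fun f) \<le> K powr p * Lp_power p f"
  shows "p \<le> K"
proof (rule ccontr)
  assume "\<not> p \<le> K"
  then have "K / p < 1" using p by simp
  \<comment> \<open>Where \<open>pole_at_1 a\<close> exceeds \<open>1 / e\<close>, the error \<open>1\<close> is at most the fraction \<open>e\<close> of it and can be absorbed. This turns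
    the factor \<open>1 / p\<close> into \<open>m\<close>, and \<open>e\<close> is so small that \<open>m * K < 1\<close> still holds.\<close>
  define e where "e = (1 - K / p) / 2"
  define m where "m = (1 / p) / (1 - e)"
  have e: "0 < e" "e < 1" "m * K < 1"
    using \<open>K / p < 1\<close> K p by (auto simp: e_def m_def field_simps)
  have m: "0 < m" using e p by (simp add: m_def)
  have th: "(m * K) powr p < 1" using powr_less_mono2[of p "m * K" 1] e m K p by simp
  have main: "(1 - (m * K) powr p) * (1 / (1 - a * p)) \<le> (1 / e) powr p" if a: "0 < a" "a < 1 / p" for a
  proof -
    note Lp = pole_at_1_Lp[OF _ a] 
    have f: "Lp_fun p (pole_at_1 a)" using Lp p by simp
    have pw: "norm (pole_at_1 a x) powr p \<le> m powr p * norm (cesaro_fun (pole_at_1 a) x) powr p + (1 / e) powr p"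
      if x: "x \<in> {0<..<1}" for x
    proof (cases "norm (pole_at_1 a x) \<le> 1 / e")
      case True
      then have "norm (pole_at_1 a x) powr p \<le> (1 / e) powr p" using p by (intro powr_mono2) auto
      then show ?thesis by (simp add: add_increasing)
    next
      case False
      have "norm (pole_at_1 a x) = norm (of_real a * of_real x * cesaro_fun (pole_at_1 a) x + 1)"
        unfolding cesaro_fun_pole_at_1[OF a(1) x] by simp
      also have "\<dots> \<le> norm (of_real a * of_real x * cesaro_fun (pole_at_1 a) x) + norm (1 :: complex)"
        by (rule norm_triangle_ineq)
      also have "\<dots> = a * x * norm (cesaro_fun (pole_at_1 a) x) + 1"
        using a x by (simp add: norm_mult)
      also have "\<dots> \<le> 1 / p * 1 * norm (cesaro_fun (pole_at_1 a) x) + e * norm (pole_at_1 a x)"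
        using a x False e p by (intro add_mono mult_mono) (auto simp: field_simps)
      finally have "(1 - e) * norm (pole_at_1 a x) \<le> 1 / p * norm (cesaro_fun (pole_at_1 a) x)"
        by (simp add: algebra_simps)
      then have "norm (pole_at_1 a x) \<le> 1 / p * norm (cesaro_fun (pole_at_1 a) x) / (1 - e)"
        using e by (subst pos_le_divide_eq) (simp_all add: mult.commute)
      then have "norm (pole_at_1 a x) \<le> m * norm (cesaro_fun (pole_at_1 a) x)"
        by (simp add: m_def)
      then have "norm (pole_at_1 a x) powr p \<le> (m * norm (cesaro_fun (pole_at_1 a) x)) powr p"
        using p by (intro powr_mono2) auto
      also have "\<dots> = m powr p * norm (cesaro_fun (pole_at_1 a) x) powr p"
        using m by (simp add: powr_mult)
      finally show ?thesis by (simp add: add_increasing2)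
    qed
    have "Lp_power p (pole_at_1 a) \<le> (\<integral>x. m powr p * norm (cesaro_fun (pole_at_1 a) x) powr p + (1 / e) powr p \<partial>I01)"
      unfolding Lp_power_def using f bound[OF f] pw
      by (intro integral_mono) (auto simp: Lp_fun_def space_I01)
    also have "\<dots> = m powr p * Lp_power p (cesaro_fun (pole_at_1 a)) + (1 / e) powr p"
      using bound[OF f]
      by (subst Bochner_Integration.integral_add)
        (auto simp: Lp_fun_def Lp_power_def space_I01 measure_restrict_space)
    also have "\<dots> \<le> m powr p * (K powr p * Lp_power p (pole_at_1 a)) + (1 / e) powr p"
      using bound[OF f] by (intro add_right_mono mult_left_mono) auto
    also have "\<dots> = (m * K) powr p * Lp_power p (pole_at_1 a) + (1 / e) powr p"
      using m K by (simp add: powr_mult)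
    finally show ?thesis
      using Lp(2) p by (simp add: diff_divide_distrib)
  qed
  define C where "C = (1 / e) powr p / (1 - (m * K) powr p)"
  have C: "0 < C" using th e by (simp add: C_def)
  \<comment> \<open>The value of \<open>a\<close> for which \<open>Lp_power p (pole_at_1 a)\<close> is \<open>C + 1\<close>.\<close>
  define a where "a = (1 - 1 / (C + 1)) / p"
  have "0 < 1 / (C + 1)" "1 / (C + 1) < 1" using C by auto
  then have "0 < a" "a < 1 / p"
    unfolding a_def using p by (auto intro!: divide_pos_pos divide_strict_right_mono)
  from main[OF this] have "1 / (1 - a * p) \<le> C"
    using th by (simp add: C_def field_simps)
  moreover have "1 - a * p = 1 / (C + 1)" using p by (simp add: a_def)
  ultimately show False by simp
qed

section \<open>Passage to equivalence classes\<close>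

lemma L0_cases:
  obtains f where "F = abs_L0 f" "f \<in> borel_measurable I01"
  by (induction F rule: L0.abs_induct) (auto simp: ae_eq_def)

lemma ae_eq_refl_iff: "ae_eq f f \<longleftrightarrow> f \<in> borel_measurable I01"
  by (simp add: ae_eq_def)

lemma abs_L0_eq_iff:
  assumes "f \<in> borel_measurable I01" "g \<in> borel_measurable I01"
  shows "abs_L0 f = abs_L0 g \<longleftrightarrow> (AE x in I01. f x = g x)"
  using assms Quotient3_rel[OF Quotient3_L0, of f g] by (simp add: ae_eq_def)

definition lift_op :: "((real \<Rightarrow> complex) \<Rightarrow> real \<Rightarrow> complex) \<Rightarrow> L0 \<Rightarrow> L0" where
  "lift_op A F = abs_L0 (A (rep_L0 F))"

lemma lift_op_abs:
  assumes "\<And>f g. ae_eq f g \<Longrightarrow> ae_eq (A f) (A g)" "f \<in> borel_measurable I01"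
  shows "lift_op A (abs_L0 f) = abs_L0 (A f)"
proof -
  have "ae_eq f f" using assms by (simp add: ae_eq_def)
  then have "ae_eq (rep_L0 (abs_L0 f)) f"
    by (rule rep_abs_rsp_left[OF Quotient3_L0])
  from assms(1)[OF this] have r: "ae_eq (A (rep_L0 (abs_L0 f))) (A f)" .
  then show ?thesis
    unfolding lift_op_def by (rule Quotient3_rel_abs[OF Quotient3_L0])
qed

lemma Lp_space_abs: "f \<in> borel_measurable I01 \<Longrightarrow> abs_L0 f \<in> Lp_space p \<longleftrightarrow> Lp_fun p f"
  by (simp add: Lp_space_def in_Lp.abs_eq Lp_fun_def ae_eq_refl_iff)

lemma Lp_norm_abs: "f \<in> borel_measurable I01 \<Longrightarrow> Lp_norm p (abs_L0 f) = Lp_power p f powr (1 / p)"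
  by (simp add: Lp_norm.abs_eq Lp_power_def ae_eq_refl_iff)

lemma Lp_space_cases:
  assumes "F \<in> Lp_space p"
  obtains f where "F = abs_L0 f" "f \<in> borel_measurable I01" "Lp_fun p f"
  using assms by (cases F rule: L0_cases) (auto simp: Lp_space_abs)

lemma cesaro_abs: "f \<in> borel_measurable I01 \<Longrightarrow> cesaro (abs_L0 f) = abs_L0 (cesaro_fun f)"
  by (simp add: cesaro.abs_eq ae_eq_refl_iff)

lemma plus_abs:
  "f \<in> borel_measurable I01 \<Longrightarrow> g \<in> borel_measurable I01 \<Longrightarrow>
    abs_L0 f + abs_L0 g = abs_L0 (\<lambda>x. f x + g x)"
  by (simp add: plus_L0.abs_eq ae_eq_refl_iff)

lemma minus_abs:
  "f \<in> borel_measurable I01 \<Longrightarrow> g \<in> borel_measurable I01 \<Longrightarrow>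
    abs_L0 f - abs_L0 g = abs_L0 (\<lambda>x. f x - g x)"
  by (simp add: minus_L0.abs_eq ae_eq_refl_iff)

lemma uminus_abs: "f \<in> borel_measurable I01 \<Longrightarrow> - abs_L0 f = abs_L0 (\<lambda>x. - f x)"
  by (simp add: uminus_L0.abs_eq ae_eq_refl_iff)

lemma scale_abs:
  "f \<in> borel_measurable I01 \<Longrightarrow> c *\<^sub>L abs_L0 f = abs_L0 (\<lambda>x. c * f x)"
  by (simp add: scaleL0.abs_eq ae_eq_refl_iff)

lemma zero_abs: "0 = abs_L0 (\<lambda>_. 0)"
  by (simp add: zero_L0_def)

interpretation L0: vector_space scaleL0
  by (rule vector_space_L0)

lemma Lp_space_scale: "F \<in> Lp_space p \<Longrightarrow> c *\<^sub>L F \<in> Lp_space p"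
  by (elim Lp_space_cases) (simp add: scale_abs Lp_space_abs Lp_fun_cmult)

lemma Lp_space_add: "F \<in> Lp_space p \<Longrightarrow> G \<in> Lp_space p \<Longrightarrow> 0 < p \<Longrightarrow> F + G \<in> Lp_space p"
  by (elim Lp_space_cases) (simp add: plus_abs Lp_space_abs Lp_fun_add)

lemma Lp_space_diff:
  assumes "F \<in> Lp_space p" "G \<in> Lp_space p" "0 < p"
  shows "F - G \<in> Lp_space p"
  using Lp_space_add[OF assms(1) Lp_space_scale[OF assms(2), of "- 1"] assms(3)]
  by (simp add: L0.scale_minus_left)

lemma Lp_norm_scale:
  assumes "F \<in> Lp_space p" "0 < p"
  shows "Lp_norm p (c *\<^sub>L F) = norm c * Lp_norm p F"
  using assms
  by (elim Lp_space_cases) (simp add: scale_abs Lp_norm_abs Lp_fun_cmult powr_mult powr_powr Lp_power_nonneg)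

lemma Lp_norm_nonneg: "0 \<le> Lp_norm p F"
  by (cases F rule: L0_cases) (simp add: Lp_norm_abs)

lemma Lp_norm_pos:
  assumes "F \<in> Lp_space p" "F \<noteq> 0"
  shows "0 < Lp_norm p F"
proof -
  obtain f where f: "F = abs_L0 f" "f \<in> borel_measurable I01" "Lp_fun p f"
    using assms(1) by (rule Lp_space_cases)
  have "Lp_power p f \<noteq> 0"
  proof
    assume "Lp_power p f = 0"
    then have "AE x in I01. norm (f x) powr p = 0"
      using f(3) unfolding Lp_power_def Lp_fun_def by (subst (asm) integral_nonneg_eq_0_iff_AE) auto
    then have "AE x in I01. f x = 0" by eventually_elim auto
    then show False using assms(2) f(2) by (simp add: f(1) zero_abs abs_L0_eq_iff)
  qed
  then show ?thesis using Lp_power_nonneg[of p f] by (simp add: f Lp_norm_abs)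
qed

lemma Lp_norm_le_iff:
  assumes "f \<in> borel_measurable I01" "g \<in> borel_measurable I01" "0 < p" "0 \<le> K"
  shows "Lp_norm p (abs_L0 f) \<le> K * Lp_norm p (abs_L0 g) \<longleftrightarrow> Lp_power p f \<le> K powr p * Lp_power p g"
proof -
  have "K * Lp_norm p (abs_L0 g) = (K powr p * Lp_power p g) powr (1 / p)"
    using assms by (simp add: Lp_norm_abs powr_mult powr_powr Lp_power_nonneg)
  moreover have "a powr (1 / p) \<le> b powr (1 / p) \<longleftrightarrow> a \<le> b" if "0 \<le> a" "0 \<le> b" for a b
    using assms that by (metis divide_pos_pos linorder_not_less powr_less_mono2 powr_mono2 zero_less_one less_imp_le)
  ultimately show ?thesis
    using assms by (simp add: Lp_norm_abs Lp_power_nonneg)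
qed

text \<open>All operators are defined on representatives. This rule transports linearity and the norm bound to the classes.\<close>

lemma Lp_bounded_liftI:
  assumes p: "0 < p"
    and cong: "\<And>f g. ae_eq f g \<Longrightarrow> ae_eq (A f) (A g)"
    and T: "\<And>f. f \<in> borel_measurable I01 \<Longrightarrow> T (abs_L0 f) = abs_L0 (A f)"
    and Lp: "\<And>f. Lp_fun p f \<Longrightarrow> Lp_fun p (A f)"
    and add: "\<And>f g. Lp_fun p f \<Longrightarrow> Lp_fun p g \<Longrightarrow> AE x in I01. A (\<lambda>x. f x + g x) x = A f x + A g x"
    and scale: "\<And>c f. Lp_fun p f \<Longrightarrow> AE x in I01. A (\<lambda>x. c * f x) x = c * A f x"
    and K: "0 \<le> K" "\<And>f. Lp_fun p f \<Longrightarrow> Lp_power p (A f) \<le> K powr p * Lp_power p f"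
  shows "Lp_bounded p T" "\<forall>F\<in>Lp_space p. Lp_norm p (T F) \<le> K * Lp_norm p F"
proof -
  have meas: "A f \<in> borel_measurable I01" if "f \<in> borel_measurable I01" for f
    using cong[of f f] that by (simp add: ae_eq_def)
  have bound: "Lp_norm p (T F) \<le> K * Lp_norm p F" if "F \<in> Lp_space p" for F
    using that by (elim Lp_space_cases) (simp add: T Lp_norm_le_iff meas p K)
  then show "\<forall>F\<in>Lp_space p. Lp_norm p (T F) \<le> K * Lp_norm p F" by blast
  show "Lp_bounded p T"
    unfolding Lp_bounded_def
  proof (intro conjI ballI allI)
    show "T ` Lp_space p \<subseteq> Lp_space p"
      by (auto elim!: Lp_space_cases simp: T Lp_space_abs meas Lp)
    show "T (F + G) = T F + T G" if FG: "F \<in> Lp_space p" "G \<in> Lp_space p" for F G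
    proof -
      obtain f g where fg: "F = abs_L0 f" "f \<in> borel_measurable I01" "Lp_fun p f"
        "G = abs_L0 g" "g \<in> borel_measurable I01" "Lp_fun p g"
        using FG by (metis Lp_space_cases)
      note [measurable] = fg(2,5) meas[OF fg(2)] meas[OF fg(5)]
      have "A (\<lambda>x. f x + g x) \<in> borel_measurable I01" by (rule meas) measurable
      then show ?thesis
        using fg add by (simp add: plus_abs T meas abs_L0_eq_iff borel_measurable_add)
    qed
    show "T (c *\<^sub>L F) = c *\<^sub>L T F" if F: "F \<in> Lp_space p" for c F
    proof -
      obtain f where f: "F = abs_L0 f" "f \<in> borel_measurable I01" "Lp_fun p f"
        using F by (rule Lp_space_cases)
      note [measurable] = f(2) meas[OF f(2)]
      have "A (\<lambda>x. c * f x) \<in> borel_measurable I01" "(\<lambda>x. c * A f x) \<in> borel_measurable I01"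
        by (rule meas; measurable) measurable
      then show ?thesis
        using f scale by (simp add: scale_abs T abs_L0_eq_iff)
    qed
    show "\<exists>K. \<forall>F\<in>Lp_space p. Lp_norm p (T F) \<le> K * Lp_norm p F"
      using bound by blast
  qed
qed

lemma cesaro_bounded:
  assumes p: "1 < p"
  shows "Lp_bounded p cesaro"
    and "F \<in> Lp_space p \<Longrightarrow> Lp_norm p (cesaro F) \<le> 1 / (1 - schur_exponent p) * Lp_norm p F"
proof -
  have cong: "ae_eq (cesaro_fun f) (cesaro_fun g)" if "ae_eq f g" for f g
    using that by (intro ae_eqI AE_I2 measurable_cesaro_fun cesaro_fun_cong_AE[OF that])
      (auto simp: ae_eq_def space_I01)
  have lin: "AE x in I01. cesaro_fun (\<lambda>x. f x + g x) x = cesaro_fun f x + cesaro_fun g x"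
    if "Lp_fun p f" "Lp_fun p g" for f g
    using cesaro_fun_linear[OF that, of _ 1 1] p by (intro AE_I2) (simp add: space_I01)
  have scale: "AE x in I01. cesaro_fun (\<lambda>x. c * f x) x = c * cesaro_fun f x" if "Lp_fun p f" for c f
    using cesaro_fun_linear[OF that that, of _ c 0] p by (intro AE_I2) (simp add: space_I01)
  have K: "0 \<le> 1 / (1 - schur_exponent p)"
    using schur_exponent_bounds[OF p] by simp
  have "0 < p" using p by simp
  note lift = Lp_bounded_liftI[where A = cesaro_fun and T = cesaro and K = "1 / (1 - schur_exponent p)",
      OF this cong cesaro_abs cesaro_fun_Lp(1)[OF p] lin scale K cesaro_fun_Lp(2)[OF p]]
  show "Lp_bounded p cesaro" by (rule lift(1))
  show "F \<in> Lp_space p \<Longrightarrow> Lp_norm p (cesaro F) \<le> 1 / (1 - schur_exponent p) * Lp_norm p F"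
    by (rule lift(2)[rule_format])
qed

section \<open>Eigenvalues and spectrum\<close>

lemma eigenvector_exists:
  assumes p: "1 \<le> p" and re: "1 - 1 / p < Re (1 / w)" "Re (1 / w) < 1 / p"
  obtains F where "F \<in> Lp_space p" "F \<noteq> 0" "cesaro F = w *\<^sub>L F"
proof (rule that[of "abs_L0 (eigenfun (1 / w))"])
  note [measurable] = eigenfun_measurable[of "1 / w"]
  have "0 \<le> 1 - 1 / p" using p by simp
  then have pos: "0 < Re (1 / w)" using re by linarith
  show "abs_L0 (eigenfun (1 / w)) \<in> Lp_space p"
    using Lp_fun_eigenfun[OF p re] by (simp add: Lp_space_abs)
  show "abs_L0 (eigenfun (1 / w)) \<noteq> 0"
  proof
    assume "abs_L0 (eigenfun (1 / w)) = 0"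
    then have "AE x in I01. eigenfun (1 / w) x = 0"
      by (simp add: zero_abs abs_L0_eq_iff)
    then have "AE x in I01. False"
      using AE_space by eventually_elim (simp add: eigenfun_def space_I01)
    then show False
      by (simp add: eventually_False ae_filter_eq_bot_iff space_I01 emeasure_restrict_space)
  qed
  have "AE x in I01. cesaro_fun (eigenfun (1 / w)) x = w * eigenfun (1 / w) x"
    using cesaro_fun_eigenfun[OF pos] by (intro AE_I2) (simp add: space_I01 field_simps)
  then show "cesaro (abs_L0 (eigenfun (1 / w))) = w *\<^sub>L abs_L0 (eigenfun (1 / w))"
    by (simp add: cesaro_abs scale_abs abs_L0_eq_iff measurable_cesaro_fun)
qed

lemma eigenvalue_iff:
  assumes p: "1 \<le> p"
  shows "w \<in> Lp_point_spectrum p cesaro \<longleftrightarrow> w \<noteq> 0 \<and> 1 - 1 / p < Re (1 / w) \<and> Re (1 / w) < 1 / p"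
proof
  assume "w \<in> Lp_point_spectrum p cesaro"
  then obtain F where F: "F \<in> Lp_space p" "F \<noteq> 0" "cesaro F = w *\<^sub>L F"
    by (auto simp: Lp_point_spectrum_def)
  obtain f where f: "F = abs_L0 f" "f \<in> borel_measurable I01" "Lp_fun p f"
    using F(1) by (rule Lp_space_cases)
  note [measurable] = f(2)
  have "AE x in I01. cesaro_fun f x = w * f x"
    using F(3) by (simp add: f(1) cesaro_abs scale_abs abs_L0_eq_iff measurable_cesaro_fun)
  moreover have "\<not> (AE x in I01. f x = 0)"
    using F(2) by (simp add: f(1) zero_abs abs_L0_eq_iff)
  ultimately show "w \<noteq> 0 \<and> 1 - 1 / p < Re (1 / w) \<and> Re (1 / w) < 1 / p"
    using cesaro_fun_eigenvalue[OF f(3) p] by blast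
next
  assume "w \<noteq> 0 \<and> 1 - 1 / p < Re (1 / w) \<and> Re (1 / w) < 1 / p"
  then show "w \<in> Lp_point_spectrum p cesaro"
    using eigenvector_exists[OF p] unfolding Lp_point_spectrum_def by blast
qed

text \<open>The resolvent \<open>1 / z + k / z\<^sup>2\<close> is a right inverse of \<open>z - T\<close>, and \<open>z - T\<close> is injective because \<open>1 / z\<close> lies outside the
  strip of eigenvalues.\<close>

lemma not_in_spectrum:
  assumes p: "1 < p" and z: "z \<noteq> 0"
    and re: "Re (1 / z) < 1 - schur_exponent p \<or> schur_exponent p < Re (1 / z)"
  shows "z \<notin> Lp_spectrum p cesaro"
proof -
  obtain N k where k: "Lp_kernel p N k"
    and comp: "\<And>f. Lp_fun p f \<Longrightarrow> AE x in I01. cesaro_fun (kernel_op k f) x = z * (kernel_op k f x - cesaro_fun f x)"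
    using resolvent_kernel_exists[OF p z re] by blast
  define R where "R f = (\<lambda>x. 1 / z * f x + 1 / z\<^sup>2 * kernel_op k f x)" for f
  define S where "S = lift_op R"
  have k_meas: "(\<lambda>(x, t). k x t) \<in> borel_measurable (I01 \<Otimes>\<^sub>M I01)"
    using k by (simp add: Lp_kernel_def)
  have cong: "ae_eq (R f) (R g)" if fg: "ae_eq f g" for f g
  proof (rule ae_eqI)
    have [measurable]: "f \<in> borel_measurable I01" "g \<in> borel_measurable I01"
      using fg by (auto simp: ae_eq_def)
    note [measurable] = kernel_op_measurable[OF k_meas]
    show "R f \<in> borel_measurable I01" "R g \<in> borel_measurable I01"
      unfolding R_def by measurable
    have "AE x in I01. f x = g x" using fg by (simp add: ae_eq_def)
    then show "AE x in I01. R f x = R g x"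
      using AE_space by eventually_elim (simp add: R_def kernel_op_cong_AE[OF k_meas fg] space_I01)
  qed
  have meas: "R f \<in> borel_measurable I01" if "f \<in> borel_measurable I01" for f
    using cong[of f f] that by (simp add: ae_eq_def)
  have S: "S (abs_L0 f) = abs_L0 (R f)" if "f \<in> borel_measurable I01" for f
    unfolding S_def using cong that by (rule lift_op_abs)
  define C where "C = 2 powr p * (norm (1 / z) powr p + norm (1 / z\<^sup>2) powr p * N powr p)"
  have C: "0 \<le> C" "(C powr (1 / p)) powr p = C" using p by (simp_all add: C_def powr_powr)
  have bounded: "Lp_bounded p S"
  proof (rule Lp_bounded_liftI(1)[where A = R and T = S and K = "C powr (1 / p)", OF _ cong S])
    fix f assume f: "Lp_fun p f"
    note inv = cesaro_right_inverse[OF p z k comp[OF f] f, folded R_def C_def]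
    show "Lp_fun p (R f)" "Lp_power p (R f) \<le> (C powr (1 / p)) powr p * Lp_power p f"
      using inv(1,2) by (simp_all add: C)
    have int: "AE x in I01. integrable I01 (\<lambda>t. k x t * f t)"
      using k f by (simp add: Lp_kernel_def)
    show "AE x in I01. R (\<lambda>x. c * f x) x = c * R f x" for c
      by (simp add: R_def kernel_op_def algebra_simps)
    fix g assume g: "Lp_fun p g"
    have "AE x in I01. integrable I01 (\<lambda>t. k x t * g t)"
      using k g by (simp add: Lp_kernel_def)
    with int show "AE x in I01. R (\<lambda>x. f x + g x) x = R f x + R g x"
      by eventually_elim (simp add: R_def kernel_op_def distrib_left add_divide_distrib)
  qed (use p in auto)
  have right: "z *\<^sub>L S F - cesaro (S F) = F" if F: "F \<in> Lp_space p" for F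
  proof -
    obtain f where f: "F = abs_L0 f" "f \<in> borel_measurable I01" "Lp_fun p f"
      using F by (rule Lp_space_cases)
    note [measurable] = f(2) meas[OF f(2)] measurable_cesaro_fun[OF meas[OF f(2)]]
    have "AE x in I01. z * R f x - cesaro_fun (R f) x = f x"
      using cesaro_right_inverse(3)[OF p z k comp[OF f(3)] f(3)] by (simp only: R_def)
    then show ?thesis
      by (simp add: f(1) S cesaro_abs scale_abs minus_abs abs_L0_eq_iff)
  qed
  have T: "cesaro F \<in> Lp_space p" "cesaro (F + G) = cesaro F + cesaro G" "cesaro (c *\<^sub>L F) = c *\<^sub>L cesaro F"
    if "F \<in> Lp_space p" "G \<in> Lp_space p" for F G c
    using cesaro_bounded(1)[OF p] that by (auto simp: Lp_bounded_def)
  have SLp: "S F \<in> Lp_space p" if "F \<in> Lp_space p" for F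
    using bounded that by (auto simp: Lp_bounded_def)
  \<comment> \<open>A right inverse of an injective operator is also a left inverse.\<close>
  have left: "S (z *\<^sub>L F - cesaro F) = F" if F: "F \<in> Lp_space p" for F
  proof (rule ccontr)
    define G where "G = S (z *\<^sub>L F - cesaro F) + (- 1) *\<^sub>L F"
    assume "S (z *\<^sub>L F - cesaro F) \<noteq> F"
    then have "G \<noteq> 0" by (simp add: G_def L0.scale_minus_left)
    have D: "z *\<^sub>L F - cesaro F \<in> Lp_space p"
      using F p by (intro Lp_space_diff Lp_space_scale T) auto
    have G: "G \<in> Lp_space p"
      unfolding G_def using F D p by (intro Lp_space_add Lp_space_scale SLp) auto
    have "cesaro G = cesaro (S (z *\<^sub>L F - cesaro F)) + cesaro ((- 1) *\<^sub>L F)"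
      unfolding G_def by (rule T(2)[OF SLp[OF D] Lp_space_scale[OF F]])
    also have "cesaro ((- 1) *\<^sub>L F) = (- 1) *\<^sub>L cesaro F"
      by (rule T(3)[OF F F])
    also have "cesaro (S (z *\<^sub>L F - cesaro F)) + (- 1) *\<^sub>L cesaro F =
        z *\<^sub>L S (z *\<^sub>L F - cesaro F) - z *\<^sub>L F"
      using right[OF D] by (simp add: L0.scale_minus_left algebra_simps)
    also have "\<dots> = z *\<^sub>L G"
      by (simp add: G_def L0.scale_right_diff_distrib)
    finally have "z \<in> Lp_point_spectrum p cesaro"
      using G \<open>G \<noteq> 0\<close> by (auto simp: Lp_point_spectrum_def)
    with p re show False
      by (auto simp: eigenvalue_iff schur_exponent_def)
  qed
  from bounded left right show ?thesis
    unfolding Lp_spectrum_def by blast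
qed

lemma resolvent_obtains:
  assumes "w \<notin> Lp_spectrum p T"
  obtains S where "Lp_bounded p S"
    "\<And>F. F \<in> Lp_space p \<Longrightarrow> S (w *\<^sub>L F - T F) = F"
    "\<And>F. F \<in> Lp_space p \<Longrightarrow> w *\<^sub>L S F - T (S F) = F"
  using assms unfolding Lp_spectrum_def by blast

lemma zero_in_spectrum:
  assumes p: "1 \<le> p"
  shows "0 \<in> Lp_spectrum p cesaro"
proof (rule ccontr)
  assume "0 \<notin> Lp_spectrum p cesaro"
  then obtain S where S: "Lp_bounded p S" "\<And>F. F \<in> Lp_space p \<Longrightarrow> 0 *\<^sub>L S F - cesaro (S F) = F"
    by (rule resolvent_obtains) blast
  define h :: "real \<Rightarrow> complex" where "h x = - (if 1 / 2 < x then 1 else 0)" for x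
  have [measurable]: "h \<in> borel_measurable I01" unfolding h_def[abs_def] by measurable
  have "Lp_fun p h" by (rule Lp_fun_bounded[where B = 1]) (use p in \<open>auto simp: h_def\<close>)
  then have H: "abs_L0 h \<in> Lp_space p" by (simp add: Lp_space_abs)
  then have "S (abs_L0 h) \<in> Lp_space p" using S(1) by (auto simp: Lp_bounded_def)
  then obtain f where f: "S (abs_L0 h) = abs_L0 f" "f \<in> borel_measurable I01" "Lp_fun p f"
    by (rule Lp_space_cases)
  note [measurable] = f(2) measurable_cesaro_fun[OF f(2)]
  have "AE x in I01. - cesaro_fun f x = h x"
    using S(2)[OF H] by (simp add: f(1) cesaro_abs uminus_abs abs_L0_eq_iff)
  then have "AE x in I01. cesaro_fun f x = (if 1 / 2 < x then 1 else 0)"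
    by eventually_elim (simp add: h_def split: if_splits)
  from cesaro_0_not_surjective[OF f(3) p this] show False .
qed

text \<open>If \<open>F\<close> is an eigenvector for \<open>w n\<close> and \<open>S\<close> a resolvent at \<open>z\<close>, then \<open>F = (z - w n) * S F\<close>, which bounds the norm of \<open>S\<close>
  from below by \<open>1 / norm (z - w n)\<close>.\<close>

lemma spectrum_eigenvalue_limit:
  assumes p: "0 < p" and w: "w \<longlonglongrightarrow> z" and ev: "\<And>n. w n \<in> Lp_point_spectrum p T"
  shows "z \<in> Lp_spectrum p T"
proof (rule ccontr)
  assume "z \<notin> Lp_spectrum p T"
  then obtain S where S: "Lp_bounded p S" "\<And>F. F \<in> Lp_space p \<Longrightarrow> S (z *\<^sub>L F - T F) = F"
    by (rule resolvent_obtains) blast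
  then obtain K where K: "\<And>F. F \<in> Lp_space p \<Longrightarrow> Lp_norm p (S F) \<le> K * Lp_norm p F"
    unfolding Lp_bounded_def by blast
  have "1 \<le> norm (z - w n) * K" for n
  proof -
    obtain F where F: "F \<in> Lp_space p" "F \<noteq> 0" "T F = w n *\<^sub>L F"
      using ev[of n] by (auto simp: Lp_point_spectrum_def)
    have "F = S ((z - w n) *\<^sub>L F)"
      using S(2)[OF F(1)] by (simp add: F(3) L0.scale_left_diff_distrib)
    also have "\<dots> = (z - w n) *\<^sub>L S F"
      using S(1) F(1) by (simp add: Lp_bounded_def)
    finally have "Lp_norm p F = Lp_norm p ((z - w n) *\<^sub>L S F)"
      by (rule arg_cong)
    also have "\<dots> = norm (z - w n) * Lp_norm p (S F)"
      using S(1) F(1) p by (intro Lp_norm_scale) (auto simp: Lp_bounded_def)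
    also have "\<dots> \<le> norm (z - w n) * (K * Lp_norm p F)"
      by (intro mult_left_mono K F) auto
    finally show ?thesis
      using Lp_norm_pos[OF F(1,2)] by (simp add: mult.assoc[symmetric])
  qed
  moreover have "(\<lambda>n. norm (z - w n) * K) \<longlonglongrightarrow> norm (z - z) * K"
    by (intro tendsto_intros w)
  ultimately have "1 \<le> norm (z - z) * K"
    by (intro tendsto_lowerbound[of "\<lambda>n. norm (z - w n) * K"]) auto
  then show False by simp
qed

text \<open>Every point of the closed strip is a limit of points of the open strip, whose inverses are eigenvalues.\<close>

lemma closed_strip_in_spectrum_lt_2:
  assumes p: "1 < p" "p < 2" and z: "z \<noteq> 0" and re: "1 - 1 / p \<le> Re (1 / z)" "Re (1 / z) \<le> 1 / p"
  shows "z \<in> Lp_spectrum p cesaro"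
proof (rule spectrum_eigenvalue_limit)
  define d where "d = 1 / p - (1 - 1 / p)"
  have d: "0 < d" using p by (simp add: d_def field_simps)
  define e :: "nat \<Rightarrow> real" where "e n = 1 / (real n + 2)" for n
  have e: "0 < e n" "e n < 1" for n by (auto simp: e_def)
  \<comment> \<open>The points \<open>v n\<close> move \<open>1 / z\<close> horizontally towards the central line \<open>Re v = 1 / 2\<close> of the strip,
    hence into its interior.\<close>
  define v where "v n = 1 / z + of_real (e n * (1 / 2 - Re (1 / z)))" for n
  have Re_v: "Re (v n) = (1 - e n) * Re (1 / z) + e n * (1 / 2)" for n
    by (simp add: v_def algebra_simps)
  have v: "1 - 1 / p < Re (v n)" "Re (v n) < 1 / p" for n
  proof -
    have "1 - 1 / p = (1 - e n) * (1 - 1 / p) + e n * (1 - 1 / p)" by (simp add: algebra_simps)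
    also have "\<dots> < Re (v n)"
      unfolding Re_v using e[of n] re d by (intro add_le_less_mono mult_left_mono mult_strict_left_mono) (auto simp: d_def)
    finally show "1 - 1 / p < Re (v n)" .
    have "Re (v n) < (1 - e n) * (1 / p) + e n * (1 / p)"
      unfolding Re_v using e[of n] re d by (intro add_le_less_mono mult_left_mono mult_strict_left_mono) (auto simp: d_def)
    then show "Re (v n) < 1 / p" by (simp add: algebra_simps)
  qed
  have "0 < 1 - 1 / p" using p by simp
  then have v0: "v n \<noteq> 0" for n using v[of n] by auto
  show "1 / v n \<in> Lp_point_spectrum p cesaro" for n
    using p v v0 by (simp add: eigenvalue_iff)
  have "(\<lambda>n. inverse (real (Suc (Suc n)))) \<longlonglongrightarrow> 0"
    using LIMSEQ_inverse_real_of_nat by (rule LIMSEQ_Suc)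
  then have "e \<longlonglongrightarrow> 0" by (simp add: e_def[abs_def] inverse_eq_divide add.commute)
  then have "v \<longlonglongrightarrow> 1 / z + of_real (0 * (1 / 2 - Re (1 / z)))"
    unfolding v_def[abs_def] by (intro tendsto_intros)
  then have "v \<longlonglongrightarrow> 1 / z" by simp
  then have "(\<lambda>n. 1 / v n) \<longlonglongrightarrow> 1 / (1 / z)"
    using z by (intro tendsto_intros) auto
  then show "(\<lambda>n. 1 / v n) \<longlonglongrightarrow> z" by simp
qed (use p in auto)

text \<open>There are no eigenvalues here; instead, the function \<open>beta_fun (1 / z)\<close> is not in the range of \<open>z - T\<close>.\<close>

lemma closed_strip_in_spectrum_ge_2:
  assumes p: "2 \<le> p" and z: "z \<noteq> 0" and re: "1 / p \<le> Re (1 / z)" "Re (1 / z) \<le> 1 - 1 / p"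
  shows "z \<in> Lp_spectrum p cesaro"
proof (rule ccontr)
  assume "z \<notin> Lp_spectrum p cesaro"
  then obtain S where S: "Lp_bounded p S" "\<And>F. F \<in> Lp_space p \<Longrightarrow> z *\<^sub>L S F - cesaro (S F) = F"
    by (rule resolvent_obtains) blast
  define h where "h x = z * beta_fun (1 / z) x" for x
  have "0 < 1 / p" using p by simp
  then have "0 < Re (1 / z)" "Re (1 / z) < 1" using re by linarith+
  then have "Lp_fun p h"
    unfolding h_def[abs_def] using p by (intro Lp_fun_cmult Lp_fun_beta_fun) auto
  note [measurable] = Lp_fun_measurable[OF this]
  have H: "abs_L0 h \<in> Lp_space p" using \<open>Lp_fun p h\<close> by (simp add: Lp_space_abs)
  then have "S (abs_L0 h) \<in> Lp_space p" using S(1) by (auto simp: Lp_bounded_def)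
  then obtain f where f: "S (abs_L0 h) = abs_L0 f" "f \<in> borel_measurable I01" "Lp_fun p f"
    by (rule Lp_space_cases)
  note [measurable] = f(2) measurable_cesaro_fun[OF f(2)]
  have "AE x in I01. z * f x - cesaro_fun f x = h x"
    using S(2)[OF H] by (simp add: f(1) cesaro_abs scale_abs minus_abs abs_L0_eq_iff)
  then show False
    using cesaro_not_surjective[OF f(3) _ z re] p by (simp add: h_def)
qed

lemma cesaro_spectrum_iff:
  assumes p: "1 < p"
  shows "z \<in> Lp_spectrum p cesaro \<longleftrightarrow>
    z = 0 \<or> 1 - schur_exponent p \<le> Re (1 / z) \<and> Re (1 / z) \<le> schur_exponent p"
proof (cases "z = 0")
  case True
  then show ?thesis using p by (simp add: zero_in_spectrum)
next
  case False
  have "z \<in> Lp_spectrum p cesaro"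
    if re: "1 - schur_exponent p \<le> Re (1 / z)" "Re (1 / z) \<le> schur_exponent p"
  proof (cases "p < 2")
    case True
    then have "1 / p \<ge> 1 / 2" using p by (intro divide_left_mono) auto
    then have "schur_exponent p = 1 / p" by (simp add: schur_exponent_def)
    with re show ?thesis
      using p True False by (intro closed_strip_in_spectrum_lt_2) auto
  next
    case ge: False
    then have "1 / p \<le> 1 / 2" using p by (intro divide_left_mono) auto
    then have "schur_exponent p = 1 - 1 / p" by (simp add: schur_exponent_def)
    with re show ?thesis
      using ge False by (intro closed_strip_in_spectrum_ge_2) auto
  qed
  with False not_in_spectrum[OF p False] show ?thesis by force
qed

section \<open>The operator norm, unboundedness for p = 1, and the disks\<close>

text \<open>The supremum over the unit ball is the least constant in the norm inequality.\<close>

lemma Lp_opnorm_eqI: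
  assumes p: "0 < p" and T: "Lp_bounded p T"
    and le: "\<And>F. F \<in> Lp_space p \<Longrightarrow> Lp_norm p (T F) \<le> N * Lp_norm p F" and N: "0 \<le> N"
    and ge: "\<And>K. 0 \<le> K \<Longrightarrow> (\<And>F. F \<in> Lp_space p \<Longrightarrow> Lp_norm p (T F) \<le> K * Lp_norm p F) \<Longrightarrow> N \<le> K"
  shows "Lp_opnorm p T = N"
proof (rule antisym)
  let ?B = "{F \<in> Lp_space p. Lp_norm p F \<le> 1}"
  have zero: "0 \<in> ?B"
    using p by (simp add: zero_abs Lp_space_abs Lp_norm_abs Lp_fun_def Lp_power_def)
  have ub: "Lp_norm p (T F) \<le> N" if "F \<in> ?B" for F
    using le[of F] that N mult_left_mono[of "Lp_norm p F" 1 N] by auto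
  then show "Lp_opnorm p T \<le> N"
    unfolding Lp_opnorm_def using zero by (intro cSUP_least) auto
  have bdd: "bdd_above ((\<lambda>F. Lp_norm p (T F)) ` ?B)"
    using ub by (intro bdd_aboveI2) auto
  show "N \<le> Lp_opnorm p T"
  proof (rule ge)
    have "Lp_norm p (T 0) \<le> Lp_opnorm p T"
      unfolding Lp_opnorm_def using bdd zero by (rule cSUP_upper2[where x = 0]) auto
    then show "0 \<le> Lp_opnorm p T" using Lp_norm_nonneg order_trans by blast
    fix F assume F: "F \<in> Lp_space p"
    show "Lp_norm p (T F) \<le> Lp_opnorm p T * Lp_norm p F"
    proof (cases "Lp_norm p F = 0")
      case True
      then show ?thesis using le[OF F] by simp
    next
      case False
      then have n: "0 < Lp_norm p F" using Lp_norm_nonneg[of p F] by simp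
      define G where "G = of_real (1 / Lp_norm p F) *\<^sub>L F"
      have "G \<in> ?B"
        using F n p by (auto simp: G_def Lp_space_scale Lp_norm_scale norm_divide)
      then have "Lp_norm p (T G) \<le> Lp_opnorm p T"
        unfolding Lp_opnorm_def using bdd by (intro cSUP_upper)
      moreover have "T G = of_real (1 / Lp_norm p F) *\<^sub>L T F" "T F \<in> Lp_space p"
        using T F by (auto simp: G_def Lp_bounded_def)
      then have "Lp_norm p (T G) = Lp_norm p (T F) / Lp_norm p F"
        using p n by (simp add: Lp_norm_scale norm_divide)
      ultimately show ?thesis using n by (simp add: field_simps)
    qed
  qed
qed

lemma eigenvalue_le_bound:
  assumes p: "0 < p" and w: "w \<in> Lp_point_spectrum p T"
    and K: "\<And>F. F \<in> Lp_space p \<Longrightarrow> Lp_norm p (T F) \<le> K * Lp_norm p F"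
  shows "norm w \<le> K"
proof -
  obtain F where F: "F \<in> Lp_space p" "F \<noteq> 0" "T F = w *\<^sub>L F"
    using w by (auto simp: Lp_point_spectrum_def)
  have "norm w * Lp_norm p F \<le> K * Lp_norm p F"
    using K[OF F(1)] F(1) p by (simp add: F(3) Lp_norm_scale)
  then show ?thesis using Lp_norm_pos[OF F(1,2)] by simp
qed

text \<open>The upper bound is the Schur test. For \<open>p < 2\<close> the eigenvalues \<open>1 / a\<close> with \<open>a\<close> close to \<open>1 - 1 / p\<close> attain it in the
  limit, for \<open>2 \<le> p\<close> the functions \<open>pole_at_1 a\<close> do.\<close>

lemma cesaro_opnorm:
  assumes p: "1 < p"
  shows "Lp_opnorm p cesaro = 1 / (1 - schur_exponent p)"
proof (rule Lp_opnorm_eqI[OF _ cesaro_bounded(1)[OF p] cesaro_bounded(2)[OF p]])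
  show "0 \<le> 1 / (1 - schur_exponent p)"
    using schur_exponent_bounds[OF p] by simp
  fix K assume K: "0 \<le> K" "\<And>F. F \<in> Lp_space p \<Longrightarrow> Lp_norm p (cesaro F) \<le> K * Lp_norm p F"
  show "1 / (1 - schur_exponent p) \<le> K"
  proof (cases "p < 2")
    case True
    then have "1 / 2 < 1 / p" using p by (intro divide_strict_left_mono) auto
    then have exp: "schur_exponent p = 1 / p" and lt: "1 - 1 / p < 1 / p" by (simp_all add: schur_exponent_def)
    have "0 < 1 - 1 / p" using p by simp
    have lower: "1 / a \<le> K" if a: "1 - 1 / p < a" "a < 1 / p" for a
    proof -
      have "0 < a" using a \<open>0 < 1 - 1 / p\<close> by linarith
      then have "of_real (1 / a) \<in> Lp_point_spectrum p cesaro"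
        using a p by (simp add: eigenvalue_iff)
      from eigenvalue_le_bound[OF _ this K(2)] p \<open>0 < a\<close> show ?thesis
        by (simp add: norm_divide)
    qed
    have "1 / (1 - 1 / p) \<le> K"
    proof (rule tendsto_upperbound)
      show "((\<lambda>a. 1 / a) \<longlongrightarrow> 1 / (1 - 1 / p)) (at_right (1 - 1 / p))"
        using \<open>0 < 1 - 1 / p\<close> by (intro tendsto_intros) auto
      show "eventually (\<lambda>a. 1 / a \<le> K) (at_right (1 - 1 / p))"
        using lt lower by (auto simp: eventually_at_right_field intro!: exI[of _ "1 / p"])
    qed simp
    then show ?thesis by (simp add: exp)
  next
    case False
    then have "1 / p \<le> 1 / 2" by (intro divide_left_mono) auto
    then have exp: "schur_exponent p = 1 - 1 / p" by (simp add: schur_exponent_def)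
    have "p \<le> K"
    proof (rule cesaro_bound_ge_p)
      fix f assume f: "Lp_fun p f"
      have [measurable]: "f \<in> borel_measurable I01" using f by (simp add: Lp_fun_def)
      have "Lp_norm p (cesaro (abs_L0 f)) \<le> K * Lp_norm p (abs_L0 f)"
        using f by (intro K) (simp add: Lp_space_abs)
      then show "Lp_fun p (cesaro_fun f) \<and> Lp_power p (cesaro_fun f) \<le> K powr p * Lp_power p f"
        using p K(1) cesaro_fun_Lp(1)[OF p f] by (simp add: cesaro_abs Lp_norm_le_iff measurable_cesaro_fun)
    qed (use p K in auto)
    then show ?thesis by (simp add: exp)
  qed
qed (use p in simp)

text \<open>For \<open>p = 1\<close> the strip of eigenvalues is \<open>0 < Re (1 / w) < 1\<close>, so there are arbitrarily large eigenvalues.\<close>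

lemma cesaro_unbounded_1: "Lp_unbounded 1 cesaro"
  unfolding Lp_unbounded_def
proof
  fix K :: real
  define a where "a = 1 / (\<bar>K\<bar> + 2)"
  have a: "0 < a" "a < 1" "K < 1 / a" by (auto simp: a_def)
  obtain F where F: "F \<in> Lp_space 1" "F \<noteq> 0" "cesaro F = of_real (1 / a) *\<^sub>L F"
    using eigenvector_exists[of 1 "of_real (1 / a)"] a by auto
  have "Lp_norm 1 (cesaro F) = 1 / a * Lp_norm 1 F"
    using F(1) a by (simp add: F(3) Lp_norm_scale norm_divide)
  then have "K * Lp_norm 1 F < Lp_norm 1 (cesaro F)"
    using a(3) Lp_norm_pos[OF F(1,2)] by (simp only: mult_strict_right_mono)
  moreover have "cesaro F \<in> Lp_space 1" using F by (simp add: Lp_space_scale)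
  ultimately show "\<exists>F\<in>Lp_space 1. cesaro F \<in> Lp_space 1 \<and> K * Lp_norm 1 F < Lp_norm 1 (cesaro F)"
    using F(1) by blast
qed

text \<open>Inversion maps the circle through \<open>0\<close> and \<open>r\<close> that is centred on the real axis to the line \<open>Re v = 1 / r\<close>.\<close>

lemma disk_iff_Re_inverse:
  assumes r: "0 < r"
  shows "z \<in> ball (complex_of_real (r / 2)) (r / 2) \<longleftrightarrow> z \<noteq> 0 \<and> 1 / r < Re (1 / z)"
    and "z \<in> cball (complex_of_real (r / 2)) (r / 2) \<longleftrightarrow> z = 0 \<or> 1 / r \<le> Re (1 / z)"
proof -
  define n where "n = (Re z)\<^sup>2 + (Im z)\<^sup>2"
  have sq: "(dist (complex_of_real (r / 2)) z)\<^sup>2 = n - r * Re z + (r / 2)\<^sup>2"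
    unfolding dist_norm cmod_power2 by (simp add: n_def power2_eq_square algebra_simps)
  have "dist (complex_of_real (r / 2)) z < r / 2 \<longleftrightarrow> (dist (complex_of_real (r / 2)) z)\<^sup>2 < (r / 2)\<^sup>2"
    using r by (intro iffI power_strict_mono) (auto dest: power_less_imp_less_base)
  then have ball: "z \<in> ball (complex_of_real (r / 2)) (r / 2) \<longleftrightarrow> n < r * Re z"
    unfolding sq by simp
  have "dist (complex_of_real (r / 2)) z \<le> r / 2 \<longleftrightarrow> (dist (complex_of_real (r / 2)) z)\<^sup>2 \<le> (r / 2)\<^sup>2"
    using r by (intro iffI power_mono) (auto dest: power2_le_imp_le)
  then have cball: "z \<in> cball (complex_of_real (r / 2)) (r / 2) \<longleftrightarrow> n \<le> r * Re z"
    unfolding sq by simp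
  have n: "z = 0 \<and> n = 0 \<or> z \<noteq> 0 \<and> 0 < n"
    unfolding n_def by (metis complex_eq_0 complex_neq_0)
  have "Re (1 / z) = Re z / n" by (simp add: n_def Re_divide)
  then show "z \<in> ball (complex_of_real (r / 2)) (r / 2) \<longleftrightarrow> z \<noteq> 0 \<and> 1 / r < Re (1 / z)"
    and "z \<in> cball (complex_of_real (r / 2)) (r / 2) \<longleftrightarrow> z = 0 \<or> 1 / r \<le> Re (1 / z)"
    unfolding ball cball using n r by (auto simp: field_simps)
qed

theorem theorem1p3:
  shows "(\<forall>p>1. Lp_bounded p cesaro) \<and> Lp_unbounded 1 cesaro \<and>
    (\<forall>p q :: real. 1 < p \<and> 1 / p + 1 / q = 1 \<longrightarrow>
      (p < 2 \<longrightarrow>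
        Lp_opnorm p cesaro = q \<and>
        Lp_point_spectrum p cesaro = ball (complex_of_real (q / 2)) (q / 2) - cball (complex_of_real (p / 2)) (p / 2) \<and>
        Lp_spectrum p cesaro = cball (complex_of_real (q / 2)) (q / 2) - ball (complex_of_real (p / 2)) (p / 2)) \<and>
      (2 \<le> p \<longrightarrow>
        Lp_opnorm p cesaro = p \<and>
        Lp_point_spectrum p cesaro = {} \<and>
        Lp_spectrum p cesaro = cball (complex_of_real (p / 2)) (p / 2) - ball (complex_of_real (q / 2)) (q / 2)))"
proof (intro conjI allI impI)
  show "Lp_bounded p cesaro" if "1 < p" for p :: real
    using that by (rule cesaro_bounded)
  show "Lp_unbounded 1 cesaro" by (rule cesaro_unbounded_1)
next
  fix p q :: real
  assume pq: "1 < p \<and> 1 / p + 1 / q = 1"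
  then have p: "1 < p" and q: "1 - 1 / p = 1 / q" by auto
  have "0 < 1 / q" using p q by (metis diff_gt_0_iff_gt divide_less_eq_1_pos less_trans zero_less_one)
  then have q0: "0 < q" by simp
  note disk_p = disk_iff_Re_inverse[of p] and disk_q = disk_iff_Re_inverse[OF q0]
  {
    assume "p < 2"
    then have "1 / 2 < 1 / p" using p by (intro divide_strict_left_mono) auto
    then have c: "schur_exponent p = 1 / p" by (simp add: schur_exponent_def)
    show "Lp_opnorm p cesaro = q"
      using q by (simp add: cesaro_opnorm[OF p] c)
    show "Lp_point_spectrum p cesaro = ball (complex_of_real (q / 2)) (q / 2) - cball (complex_of_real (p / 2)) (p / 2)"
      using p by (auto simp only: set_eq_iff Diff_iff eigenvalue_iff disk_p disk_q q less_imp_le not_le)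
    show "Lp_spectrum p cesaro = cball (complex_of_real (q / 2)) (q / 2) - ball (complex_of_real (p / 2)) (p / 2)"
      using p by (auto simp only: set_eq_iff Diff_iff cesaro_spectrum_iff c disk_p disk_q q not_less)
  next
    assume "2 \<le> p"
    then have le: "1 / p \<le> 1 / 2" by (intro divide_left_mono) auto
    then have c: "schur_exponent p = 1 - 1 / p" by (simp add: schur_exponent_def)
    show "Lp_opnorm p cesaro = p"
      by (simp add: cesaro_opnorm[OF p] c)
    show "Lp_point_spectrum p cesaro = {}"
    proof (rule equals0I)
      fix w assume "w \<in> Lp_point_spectrum p cesaro"
      then have "1 - 1 / p < Re (1 / w)" "Re (1 / w) < 1 / p"
        unfolding eigenvalue_iff[OF less_imp_le[OF p]] by blast+
      then show False using le by linarith
    qed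
    have c': "1 - (1 - 1 / p) = 1 / p" by simp
    show "Lp_spectrum p cesaro = cball (complex_of_real (p / 2)) (p / 2) - ball (complex_of_real (q / 2)) (q / 2)"
      using p unfolding set_eq_iff Diff_iff cesaro_spectrum_iff[OF p] c c'
      by (auto simp only: disk_p disk_q q not_less)
  }
qed

end
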